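(* Let $\tilde V:\mathbb{R}\to\mathbb{R}$ be the limit, as $\varepsilon\to0^+$, of the thermostatic value functions (see context). For each bounded, continuous viscosity subsolution $u:\mathbb{R}\to\mathbb{R}$ of $$\begin{cases}\lambda V+H_1(x,V')=0 & \text{in } \{x>0\},\\ \lambda V+H_{-1}(x,V')=0 & \text{in } \{x<0\},\\ \min\{\lambda V+H_1,\ \lambda V+H_{-1}\}\le0 & \text{on } x=0,\end{cases}$$ one has $u\le\tilde V$ in $\mathbb{R}$.
   Context: Data. $A$ is a compact control set, $\lambda>0$, and $\mathcal{A}$ is the set of measurable controls $\alpha:[0,+\infty)\to A$. Branch $1$ is $[0,+\infty)$ and branch $-1$ is $(-\infty,0]$. The dynamics $f_1:[0,+\infty)\times A\to\mathbb{R}$, $f_{-1}:(-\infty,0]\times A\to\mathbb{R}$ and the running costs $\ell_1:[0,+\infty)\times A\to[0,+\infty)$, $\ell_{-1}:(-\infty,0]\times A\to[0,+\infty)$ are continuous and bounded. Standing assumptions: there is $L>0$ with $|f_i(x,a)-f_i(y,a)|\le L|x-y|$; for each $i=\pm1$ there are $a_i^-,a_i^+\in A$ with $f_i(0,a_i^-)<0<f_i(0,a_i^+)$; there is a continuous increasing $\omega_\ell:[0,\infty)\to[0,\infty)$, $\omega_\ell(0)=0$, with $|\ell_i(x,a)-\ell_i(y,a)|\le\omega_\ell(|x-y|)$. For $\varepsilon>0$, $f_1,\ell_1$ are extended to $[-\varepsilon,+\infty)\times A$ and $f_{-1},\ell_{-1}$ to $(-\infty,\varepsilon]\times A$ by constancy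 in $x$. Delayed thermostat. For a continuous scalar input $v$ and an initial output $i_0\in\{-1,1\}$ coherent with $v(0)$ ($i_0=1$ if $v(0)>\varepsilon$, $i_0=-1$ if $v(0)<-\varepsilon$), $h_\varepsilon[v](t)\in\{-1,1\}$ is the unique output with initial value $i_0$ such that: it jumps from $1$ to $-1$ when, and only when, $v$, coming from values $\ge-\varepsilon$, goes below $-\varepsilon$; it jumps from $-1$ to $1$ when, and only when, $v$, coming from values $\le\varepsilon$, goes above $\varepsilon$; otherwise it stays constant. Approximating problem. For $(x_0,i_0)\in([-\varepsilon,+\infty)\times\{1\})\cup((-\infty,\varepsilon]\times\{-1\})$ and $\alpha\in\mathcal A$ let $(x(t),i(t))$ solve $x'(t)=f_{i(t)}(x(t),\alpha(t))$, $i(t)=h_\varepsilon[x](t)$, $x(0)=x_0$, $i(0)=i_0$, and put $$V_\varepsilon(x_0,i_0)=\inf_{\alpha\in\mathcal A}\int_0^\infty e^{-\lambda t}\ell_{i(t)}(x(t),\alpha(t))\,dt.$$ Let $\tilde V_\varepsilon(x)=V_\varepsilon(x,1)$ for $x>0$ and $\tilde V_\varepsilon(x)=V_\varepsilon(x,-1)$ for $x<0$. Under the standing assumptions, $\tilde V_\varepsilon$ converges uniformly on $\mathbb{R}\setminus\{0\}$ as $\varepsilon\to0^+$, and the limit extends continuously to $\mathbb{R}$; $\tilde V$ denotes this extension. Hamiltonians: $H_i(x,p)=\sup_{a\in A}\{-f_i(x,a)p-\ell_i(x,a)\}$, $i=\pm1$. Subsolution. A continuous $u$ is a subsolution of the problem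 if it is a viscosity subsolution of the two equations on the open half-lines in the usual sense and, for every $\varphi\in C^1(\mathbb{R})$ such that $u-\varphi$ has a local maximum at $0$, $\min\{\lambda u(0)+H_1(0,\varphi'(0)),\lambda u(0)+H_{-1}(0,\varphi'(0))\}\le0$. *)

theory Defs
  imports "HOL-Analysis.Analysis"
begin

text \<open>Branches are labelled by the integers \<open>1\<close> and \<open>-1\<close>.\<close>

definition branch :: "int \<Rightarrow> real set" where
  "branch i = (if i = 1 then {0..} else {..0})"

locale junction_control =
  fixes A :: "'a::topological_space set"
    and lam :: real
    and f l :: "int \<Rightarrow> real \<Rightarrow> 'a \<Rightarrow> real"
  assumes compact_A: "compact A"
    and lam_pos: "lam > 0"
    and f_continuous: "\<And>i. i \<in> {1, -1} \<Longrightarrow> continuous_on (branch i \<times> A) (\<lambda>(x, a). f i x a)"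
    and l_continuous: "\<And>i. i \<in> {1, -1} \<Longrightarrow> continuous_on (branch i \<times> A) (\<lambda>(x, a). l i x a)"
    and f_bounded: "\<And>i. i \<in> {1, -1} \<Longrightarrow> bounded ((\<lambda>(x, a). f i x a) ` (branch i \<times> A))"
    and l_bounded: "\<And>i. i \<in> {1, -1} \<Longrightarrow> bounded ((\<lambda>(x, a). l i x a) ` (branch i \<times> A))"
    and l_nonneg: "\<And>i x a. \<lbrakk>i \<in> {1, -1}; x \<in> branch i; a \<in> A\<rbrakk> \<Longrightarrow> 0 \<le> l i x a"
    and f_Lipschitz: "\<exists>L>0. \<forall>i\<in>{1, -1}. \<forall>x\<in>branch i. \<forall>y\<in>branch i. \<forall>a\<in>A.
           \<bar>f i x a - f i y a\<bar> \<le> L * \<bar>x - y\<bar>"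
    and controllable: "\<And>i. i \<in> {1, -1} \<Longrightarrow> \<exists>am\<in>A. \<exists>ap\<in>A. f i 0 am < 0 \<and> 0 < f i 0 ap"
    and l_modulus: "\<exists>\<omega> :: real \<Rightarrow> real. continuous_on {0..} \<omega> \<and> mono_on {0..} \<omega> \<and> \<omega> 0 = 0 \<and>
           (\<forall>i\<in>{1, -1}. \<forall>x\<in>branch i. \<forall>y\<in>branch i. \<forall>a\<in>A.
              \<bar>l i x a - l i y a\<bar> \<le> \<omega> \<bar>x - y\<bar>)"

text \<open>Extension by constancy in the space variable: \<open>g i\<close> is only ever evaluated on \<open>branch i\<close>.\<close>

definition extend_const :: "(int \<Rightarrow> real \<Rightarrow> 'a \<Rightarrow> real) \<Rightarrow> int \<Rightarrow> real \<Rightarrow> 'a \<Rightarrow> real" where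
  "extend_const g i x a = g i (if i = 1 then max x 0 else min x 0) a"

definition controls :: "'a::topological_space set \<Rightarrow> (real \<Rightarrow> 'a) set" where
  "controls A = {\<alpha>. \<alpha> \<in> measurable (lebesgue_on {0..}) borel \<and> (\<forall>t\<ge>0. \<alpha> t \<in> A)}"

text \<open>
  \<open>thermostat \<epsilon> v i0 i\<close> states that \<open>i\<close> is the output on \<open>[0,\<infinity>)\<close> of the delayed relay with
  thresholds \<open>-\<epsilon>\<close> and \<open>\<epsilon>\<close>, for the input \<open>v\<close> and the initial output \<open>i0\<close>. The two
  threshold clauses say that a jump happens whenever the threshold is crossed (at \<open>t = 0\<close> they
  express the coherence of \<open>i0\<close> with \<open>v 0\<close>); the two persistence clauses say that a jump happens
  only then. At the jump instant itself, where \<open>v\<close> equals the threshold, the output still has its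
  old value.
\<close>

definition thermostat :: "real \<Rightarrow> (real \<Rightarrow> real) \<Rightarrow> int \<Rightarrow> (real \<Rightarrow> int) \<Rightarrow> bool" where
  "thermostat \<epsilon> v i0 i \<longleftrightarrow>
     continuous_on {0..} v \<and> i 0 = i0 \<and> (\<forall>t\<ge>0. i t \<in> {1, -1}) \<and>
     (\<forall>t\<ge>0. v t < -\<epsilon> \<longrightarrow> i t = -1) \<and>
     (\<forall>t\<ge>0. v t > \<epsilon> \<longrightarrow> i t = 1) \<and>
     (\<forall>s t. 0 \<le> s \<and> s \<le> t \<and> i s = 1 \<and> (\<forall>r\<in>{s..t}. v r \<ge> -\<epsilon>) \<longrightarrow> i t = 1) \<and>
     (\<forall>s t. 0 \<le> s \<and> s \<le> t \<and> i s = -1 \<and> (\<forall>r\<in>{s..t}. v r \<le> \<epsilon>) \<longrightarrow> i t = -1)"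

text \<open>The differential equation is understood in the Caratheodory sense, i.e. in integral form.\<close>

definition trajectory ::
  "(int \<Rightarrow> real \<Rightarrow> 'a \<Rightarrow> real) \<Rightarrow> real \<Rightarrow> real \<Rightarrow> int \<Rightarrow> (real \<Rightarrow> 'a)
     \<Rightarrow> (real \<Rightarrow> real) \<Rightarrow> (real \<Rightarrow> int) \<Rightarrow> bool" where
  "trajectory f \<epsilon> x0 i0 \<alpha> x i \<longleftrightarrow>
     (\<forall>t\<ge>0. set_integrable lebesgue {0..t} (\<lambda>s. extend_const f (i s) (x s) (\<alpha> s)) \<and>
        x t = x0 + (LINT s:{0..t}|lebesgue. extend_const f (i s) (x s) (\<alpha> s))) \<and>
     thermostat \<epsilon> x i0 i"

definition cost ::
  "(int \<Rightarrow> real \<Rightarrow> 'a \<Rightarrow> real) \<Rightarrow> real \<Rightarrow> (real \<Rightarrow> 'a) \<Rightarrow> (real \<Rightarrow> real) \<Rightarrow> (real \<Rightarrow> int) \<Rightarrow> real" where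
  "cost l lam \<alpha> x i =
     (LINT t:{0..}|lebesgue. exp (- lam * t) * extend_const l (i t) (x t) (\<alpha> t))"

definition value_fun ::
  "'a::topological_space set \<Rightarrow> real \<Rightarrow> (int \<Rightarrow> real \<Rightarrow> 'a \<Rightarrow> real) \<Rightarrow> (int \<Rightarrow> real \<Rightarrow> 'a \<Rightarrow> real)
     \<Rightarrow> real \<Rightarrow> real \<Rightarrow> int \<Rightarrow> real" where
  "value_fun A lam f l \<epsilon> x0 i0 =
     Inf {cost l lam \<alpha> x i |\<alpha> x i. \<alpha> \<in> controls A \<and> trajectory f \<epsilon> x0 i0 \<alpha> x i}"

text \<open>Only the values at \<open>x \<noteq> 0\<close> are meaningful.\<close>

definition glued_value ::
  "'a::topological_space set \<Rightarrow> real \<Rightarrow> (int \<Rightarrow> real \<Rightarrow> 'a \<Rightarrow> real) \<Rightarrow> (int \<Rightarrow> real \<Rightarrow> 'a \<Rightarrow> real)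
     \<Rightarrow> real \<Rightarrow> real \<Rightarrow> real" where
  "glued_value A lam f l \<epsilon> x = value_fun A lam f l \<epsilon> x (if x > 0 then 1 else -1)"

definition hamiltonian ::
  "'a set \<Rightarrow> (int \<Rightarrow> real \<Rightarrow> 'a \<Rightarrow> real) \<Rightarrow> (int \<Rightarrow> real \<Rightarrow> 'a \<Rightarrow> real) \<Rightarrow> int \<Rightarrow> real \<Rightarrow> real \<Rightarrow> real"
  where "hamiltonian A f l i x p = (SUP a\<in>A. - f i x a * p - l i x a)"

definition C1_on :: "real set \<Rightarrow> (real \<Rightarrow> real) \<Rightarrow> (real \<Rightarrow> real) \<Rightarrow> bool" where
  "C1_on \<Omega> \<phi> \<phi>' \<longleftrightarrow>
     (\<forall>x\<in>\<Omega>. (\<phi> has_real_derivative \<phi>' x) (at x)) \<and> continuous_on \<Omega> \<phi>'"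

definition local_max_at :: "(real \<Rightarrow> real) \<Rightarrow> real \<Rightarrow> bool" where
  "local_max_at g x \<longleftrightarrow> (\<forall>\<^sub>F y in nhds x. g y \<le> g x)"

text \<open>Viscosity subsolutions of \<open>F (x, u, u') = 0\<close> on an open set \<open>\<Omega>\<close>.\<close>

definition viscosity_subsolution_on ::
  "real set \<Rightarrow> (real \<Rightarrow> real \<Rightarrow> real \<Rightarrow> real) \<Rightarrow> (real \<Rightarrow> real) \<Rightarrow> bool" where
  "viscosity_subsolution_on \<Omega> F u \<longleftrightarrow>
     (\<forall>\<phi> \<phi>'. C1_on \<Omega> \<phi> \<phi>' \<longrightarrow>
        (\<forall>x\<in>\<Omega>. local_max_at (\<lambda>y. u y - \<phi> y) x \<longrightarrow> F x (u x) (\<phi>' x) \<le> 0))"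

definition junction_subsolution ::
  "'a set \<Rightarrow> real \<Rightarrow> (int \<Rightarrow> real \<Rightarrow> 'a \<Rightarrow> real) \<Rightarrow> (int \<Rightarrow> real \<Rightarrow> 'a \<Rightarrow> real)
     \<Rightarrow> (real \<Rightarrow> real) \<Rightarrow> bool" where
  "junction_subsolution A lam f l u \<longleftrightarrow>
     continuous_on UNIV u \<and>
     viscosity_subsolution_on {0<..} (\<lambda>x r p. lam * r + hamiltonian A f l 1 x p) u \<and>
     viscosity_subsolution_on {..<0} (\<lambda>x r p. lam * r + hamiltonian A f l (-1) x p) u \<and>
     (\<forall>\<phi> \<phi>'. C1_on UNIV \<phi> \<phi>' \<and> local_max_at (\<lambda>y. u y - \<phi> y) 0 \<longrightarrow>
        min (lam * u 0 + hamiltonian A f l 1 0 (\<phi>' 0))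
            (lam * u 0 + hamiltonian A f l (-1) 0 (\<phi>' 0)) \<le> 0)"

end

theory Submission imports Defs begin

text \<open>
  Why \<open>u \<le> V\<close>. For each \<open>\<epsilon>\<close> a function \<open>W\<^sub>\<epsilon> j\<close> is built from \<open>u\<close> for each mode
  \<open>j = \<plusminus>1\<close> of the thermostat, which is a subsolution of the equation of that mode, up to an error
  \<open>e(\<epsilon>) \<rightarrow> 0\<close>, on the whole region \<open>j x \<ge> - \<epsilon>\<close> in which the mode can be active, and which does not
  decrease at the two switching points: \<open>W\<^sub>\<epsilon> 1 (- \<epsilon>) \<le> W\<^sub>\<epsilon> (-1) (- \<epsilon>)\<close> and
  \<open>W\<^sub>\<epsilon> (-1) \<epsilon> \<le> W\<^sub>\<epsilon> 1 \<epsilon>\<close>. Along every trajectory \<open>(x, i)\<close> of the thermostatic problem the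
  quantity \<open>exp (- \<lambda> t) W\<^sub>\<epsilon> (i t) (x t)\<close> plus the discounted cost (with running cost increased by
  \<open>e(\<epsilon>)\<close>) up to time \<open>t\<close> is then nondecreasing, so that
  \<open>W\<^sub>\<epsilon> i\<^sub>0 x\<^sub>0 - e(\<epsilon>) / \<lambda>\<close> bounds the value from below (\<open>test_value_le_cost\<close>). As
  \<open>\<epsilon> \<rightarrow> 0\<close>, \<open>W\<^sub>\<epsilon>\<close> tends to \<open>u\<close> off the origin, and the origin is reached by continuity.

  The functions \<open>W\<^sub>\<epsilon> j\<close> are affine with value \<open>u 0\<close> at \<open>0\<close> and slope \<open>p\<^sub>j\<close> for
  \<open>j x \<le> \<epsilon>\<close>, and equal \<open>u\<close> plus a constant for \<open>j x > \<epsilon>\<close>. The equation at \<open>0\<close> requires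
  \<open>\<lambda> u(0) + H\<^sub>j(0, p\<^sub>j) \<le> 0\<close>, and the switching conditions amount to \<open>p\<^sub>-\<^sub>1 \<le> p\<^sub>1\<close>. The slopes
  admissible for a branch form a nonempty closed set that is bounded on the side that matters; the
  extreme choice is the largest \<open>p\<^sub>1\<close> and the smallest \<open>p\<^sub>-\<^sub>1\<close>. If these violated \<open>p\<^sub>-\<^sub>1 \<le> p\<^sub>1\<close>,
  any \<open>p\<close> strictly between them would make \<open>u x - p x\<close> have a local maximum at \<open>0\<close>, because the
  equations on the half-lines force \<open>u\<close> to grow more slowly than \<open>p x\<close> on the right and to be
  steeper than \<open>p x\<close> on the left; the condition at the junction would then make \<open>p\<close> admissible for one of the two
  branches, a contradiction (\<open>slopes_compatible\<close>).

  Within one mode, monotonicity along a trajectory (\<open>suboptimality\<close>) uses neither Lipschitz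
  continuity of \<open>u\<close> nor a chain rule. A sup-convolution has at every point a parabola of fixed
  opening touching it from below, with a slope that is also the slope of a parabola touching the
  original function from above at a nearby point. Over a time step of length \<open>h\<close> this gives the
  desired inequality up to \<open>o(1) h\<close>, and summing over steps needs only the integral form of the
  equation of motion, hence works for merely measurable controls.

  The two branches are treated together by means of the branch coordinate \<open>X = j x\<close>, in which both
  become the half-line \<open>X \<ge> 0\<close>.
\<close>

section \<open>Test functions\<close>

lemma local_max_at_scale:
  fixes \<sigma> :: real
  assumes "\<sigma> * \<sigma> = 1" "local_max_at (\<lambda>y. u (\<sigma> * y) - \<phi> y) x"
  shows "local_max_at (\<lambda>y. u y - \<phi> (\<sigma> * y)) (\<sigma> * x)"
proof -
  have *: "\<sigma> * (\<sigma> * y) = y" for y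
    using assms(1) by (metis mult.assoc mult_1)
  have "filterlim (\<lambda>y. \<sigma> * y) (nhds (\<sigma> * (\<sigma> * x))) (nhds (\<sigma> * x))"
    by (intro tendsto_intros filterlim_ident)
  then have "filterlim (\<lambda>y. \<sigma> * y) (nhds x) (nhds (\<sigma> * x))"
    by (simp add: *)
  with assms(2) show ?thesis
    unfolding local_max_at_def by (auto simp: * filterlim_iff)
qed

lemma C1_on_scale:
  fixes \<sigma> :: real
  assumes "C1_on UNIV \<phi> \<phi>'"
  shows "C1_on UNIV (\<lambda>y. \<phi> (\<sigma> * y)) (\<lambda>y. \<sigma> * \<phi>' (\<sigma> * y))"
  unfolding C1_on_def
proof (intro conjI ballI)
  fix y :: real
  have "(\<phi> has_real_derivative \<phi>' (\<sigma> * y)) (at (\<sigma> * y))"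
    using assms by (auto simp: C1_on_def)
  moreover have "((\<lambda>y. \<sigma> * y) has_real_derivative \<sigma>) (at y)"
    by (auto intro!: derivative_eq_intros)
  ultimately show "((\<lambda>y. \<phi> (\<sigma> * y)) has_real_derivative \<sigma> * \<phi>' (\<sigma> * y)) (at y)"
    by (metis (no_types) DERIV_chain2 mult.commute)
next
  show "continuous_on UNIV (\<lambda>y. \<sigma> * \<phi>' (\<sigma> * y))"
    using assms unfolding C1_on_def
    by (auto intro!: continuous_intros continuous_on_compose2[of UNIV \<phi>'])
qed

text \<open>
  One-sided mean value inequalities for functions that are only continuous: somewhere in the
  interior, a smooth function touching \<open>w\<close> from above has slope less (greater) than \<open>s\<close>.
\<close>

lemma exists_test_slope_less:
  fixes w :: "real \<Rightarrow> real"
  assumes "a < b" and cont: "continuous_on {a..b} w" and less: "w b - w a < s * (b - a)"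
  obtains \<phi> \<phi>' z where "C1_on UNIV \<phi> \<phi>'" "a < z" "z < b"
    "local_max_at (\<lambda>y. w y - \<phi> y) z" "\<phi>' z < s"
proof -
  define h where "h z = w z - s * z" for z
  define D where "D = h a - h b"
  have D: "D > 0" using less by (simp add: D_def h_def algebra_simps)
  have hc: "continuous_on {a..b} h" unfolding h_def by (intro continuous_intros cont)
  have "(h \<longlongrightarrow> h a) (at a within {a..b})"
    using hc \<open>a < b\<close> by (auto simp: continuous_on_def)
  then have "\<forall>\<^sub>F z in at_right a. h z > h a - D/2"
    using order_tendstoD(1)[of h "h a" "at a within {a..b}" "h a - D/2"] D \<open>a < b\<close>
    by (simp add: at_within_Icc_at_right)
  moreover have "\<forall>\<^sub>F z in at_right a. z \<in> {a<..<b}"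
    by (rule eventually_at_right_real[OF \<open>a < b\<close>])
  ultimately obtain z0 where z0: "h z0 > h a - D/2" "a < z0" "z0 < b"
    using eventually_happens'[OF trivial_limit_at_right_real eventually_conj] by force
  \<comment> \<open>A steep decreasing exponential lowers the value at \<open>a\<close> by \<open>D\<close> but the value at \<open>z0\<close> only by
    \<open>D / 4\<close>, so that the maximum of the difference is attained in the interior.\<close>
  define k where "k = ln 4 / (z0 - a)"
  have k: "k > 0" using z0 by (simp add: k_def)
  define e where "e z = D * exp (- k * (z - a))" for z
  have "k * (z0 - a) = ln 4" using z0 by (simp add: k_def)
  then have e0: "e z0 = D / 4" by (simp add: e_def exp_minus field_simps)
  have epos: "e z > 0" for z using D by (simp add: e_def)
  define G where "G z = h z - e z" for z
  have "continuous_on {a..b} G"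
    unfolding G_def e_def by (intro continuous_intros hc)
  then obtain z where z: "z \<in> {a..b}" "\<And>y. y \<in> {a..b} \<Longrightarrow> G y \<le> G z"
    using continuous_attains_sup[of "{a..b}" G] \<open>a < b\<close> by (auto simp: compact_Icc)
  have "G z0 > G a" using z0 e0 D by (simp add: G_def e_def[of a])
  moreover have "G z0 > G b"
  proof -
    have "h b = h a - D" by (simp add: D_def)
    moreover have "h a - D / 2 < h z0" by (rule z0(1))
    ultimately have "h b < h z0 - D / 4" using D by (simp add: field_simps)
    then show ?thesis using e0 epos[of b] by (simp add: G_def)
  qed
  ultimately have "a < z" "z < b" using z(1) z(2)[of z0] z0 by (force simp: less_le)+
  show ?thesis
  proof
    show "C1_on UNIV (\<lambda>z. s * z + e z) (\<lambda>z. s - k * e z)"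
      unfolding C1_on_def e_def
      by (auto intro!: derivative_eq_intros continuous_intros)
    have "\<forall>\<^sub>F y in nhds z. y \<in> {a<..<b}"
      using \<open>a < z\<close> \<open>z < b\<close> by (intro eventually_nhds_in_open) auto
    then show "local_max_at (\<lambda>y. w y - (s * y + e y)) z"
      unfolding local_max_at_def
    proof eventually_elim
      case (elim y)
      then show ?case using z(2)[of y] by (simp add: G_def h_def)
    qed
    show "s - k * e z < s" using k epos[of z] by simp
  qed fact+
qed

lemma exists_test_slope_greater:
  fixes w :: "real \<Rightarrow> real"
  assumes "a < b" and cont: "continuous_on {a..b} w" and less: "w b - w a > s * (b - a)"
  obtains \<phi> \<phi>' z where "C1_on UNIV \<phi> \<phi>'" "a < z" "z < b"
    "local_max_at (\<lambda>y. w y - \<phi> y) z" "\<phi>' z > s"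
proof -
  have "continuous_on {-b..-a} (\<lambda>z. w (- z))"
    by (rule continuous_on_compose2[OF cont]) (auto intro!: continuous_intros)
  moreover have "w (- (- a)) - w (- (- b)) < (- s) * (- a - - b)"
    using less by (simp add: algebra_simps)
  ultimately obtain \<phi> \<phi>' z where *: "C1_on UNIV \<phi> \<phi>'" "- b < z" "z < - a"
    "local_max_at (\<lambda>y. w (- y) - \<phi> y) z" "\<phi>' z < - s"
    using exists_test_slope_less[of "-b" "-a" "\<lambda>z. w (- z)" "- s"] \<open>a < b\<close> by auto
  show ?thesis
  proof
    show "C1_on UNIV (\<lambda>y. \<phi> (-1 * y)) (\<lambda>y. -1 * \<phi>' (-1 * y))"
      by (rule C1_on_scale) fact
    show "local_max_at (\<lambda>y. w y - \<phi> (-1 * y)) (-1 * z)"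
      by (rule local_max_at_scale) (use * in auto)
    show "s < -1 * \<phi>' (-1 * (-1 * z))" using * by simp
  qed (use * in auto)
qed

section \<open>Subsolutions on a half-line\<close>

text \<open>
  A single branch in the coordinate \<open>X \<ge> 0\<close>: dynamics \<open>g\<close>, running cost \<open>c\<close>, and a function \<open>u\<close> that
  is a viscosity subsolution for \<open>X > 0\<close>. The Hamiltonian is replaced by its defining inequalities,
  one for each control value.
\<close>

locale half_line_subsolution =
  fixes A :: "'a set" and lam L M :: real and \<omega> :: "real \<Rightarrow> real"
    and g c :: "real \<Rightarrow> 'a \<Rightarrow> real" and u :: "real \<Rightarrow> real"
  assumes lam_pos: "0 < lam" and L_nonneg: "0 \<le> L"
    and g_Lipschitz: "\<lbrakk>0 \<le> x; 0 \<le> y; a \<in> A\<rbrakk> \<Longrightarrow> \<bar>g x a - g y a\<bar> \<le> L * \<bar>x - y\<bar>"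
    and g_bound: "\<lbrakk>0 \<le> x; a \<in> A\<rbrakk> \<Longrightarrow> \<bar>g x a\<bar> \<le> M"
    and c_nonneg: "\<lbrakk>0 \<le> x; a \<in> A\<rbrakk> \<Longrightarrow> 0 \<le> c x a"
    and \<omega>_cont: "continuous_on {0..} \<omega>" and \<omega>_mono: "mono_on {0..} \<omega>" and \<omega>_0: "\<omega> 0 = 0"
    and c_modulus: "\<lbrakk>0 \<le> x; 0 \<le> y; a \<in> A\<rbrakk> \<Longrightarrow> \<bar>c x a - c y a\<bar> \<le> \<omega> \<bar>x - y\<bar>"
    and inward: "\<exists>a\<in>A. g 0 a < 0" and outward: "\<exists>a\<in>A. 0 < g 0 a"
    and u_cont: "continuous_on UNIV u"
    and subsolution: "\<lbrakk>C1_on UNIV \<phi> \<phi>'; 0 < x; local_max_at (\<lambda>y. u y - \<phi> y) x; a \<in> A\<rbrakk>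
       \<Longrightarrow> lam * u x - g x a * \<phi>' x - c x a \<le> 0"
begin

lemma \<omega>_nonneg: "0 \<le> r \<Longrightarrow> 0 \<le> \<omega> r"
  using \<omega>_mono \<omega>_0 by (metis atLeast_iff mono_onD order_refl)

lemma \<omega>_tendsto: "(\<omega> \<longlongrightarrow> 0) (at_right 0)"
proof -
  have "(\<omega> \<longlongrightarrow> \<omega> 0) (at 0 within {0..})"
    using \<omega>_cont by (auto simp: continuous_on_def)
  then show ?thesis by (simp add: \<omega>_0 at_within_Ici_at_right)
qed

lemma g_continuous: "a \<in> A \<Longrightarrow> continuous_on {0..} (\<lambda>x. g x a)"
  by (rule lipschitz_on_continuous_on[of L])
     (auto simp: lipschitz_on_def dist_real_def g_Lipschitz L_nonneg)

lemma c_continuous: "a \<in> A \<Longrightarrow> continuous_on {0..} (\<lambda>x. c x a)"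
proof -
  assume a: "a \<in> A"
  have "((\<lambda>x. c x a) \<longlongrightarrow> c y a) (at y within {0..})" if "0 \<le> y" for y
  proof -
    have "((\<lambda>x. \<bar>x - y\<bar>) \<longlongrightarrow> \<bar>y - y\<bar>) (at y within {0..})"
      by (intro tendsto_intros)
    then have "((\<lambda>x. \<omega> \<bar>x - y\<bar>) \<longlongrightarrow> \<omega> 0) (at y within {0..})"
      by (intro continuous_on_tendsto_compose[OF \<omega>_cont]) auto
    then have "((\<lambda>x. \<omega> \<bar>x - y\<bar>) \<longlongrightarrow> 0) (at y within {0..})"
      by (simp add: \<omega>_0)
    then have "((\<lambda>x. c x a - c y a) \<longlongrightarrow> 0) (at y within {0..})"
      by (rule Lim_null_comparison[rotated])
         (auto simp: eventually_at_filter intro!: c_modulus a that always_eventually)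
    then show ?thesis by (rule LIM_zero_cancel)
  qed
  then show ?thesis by (simp add: continuous_on_def)
qed

text \<open>
  If the slope \<open>s\<close> violates the inequality of some control \<open>a\<close> at \<open>y\<close>, it violates it on a right
  neighbourhood of \<open>y\<close>. When \<open>a\<close> moves to the right (left), every slope smaller (larger)
  than \<open>s\<close> violates it as well, so the increments of \<open>u\<close> from \<open>y\<close> are bounded from below (above).
\<close>

lemma violation_near:
  assumes "0 \<le> y" "a \<in> A" "lam * u y - g y a * s - c y a > 0" "g y a \<noteq> 0"
  obtains \<delta> where "\<delta> > 0" "\<And>z. \<lbrakk>y < z; z < y + \<delta>\<rbrakk> \<Longrightarrow> lam * u z - g z a * s - c z a > 0"
    "\<And>z. \<lbrakk>y < z; z < y + \<delta>\<rbrakk> \<Longrightarrow> g z a * g y a > 0"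
proof -
  have sub: "at_right y \<le> at y within {0..}"
    using assms(1) by (intro at_le) auto
  have g: "((\<lambda>z. g z a) \<longlongrightarrow> g y a) (at_right y)"
    using g_continuous[OF assms(2)] assms(1) sub
    by (auto simp: continuous_on_def intro: tendsto_mono)
  have c: "((\<lambda>z. c z a) \<longlongrightarrow> c y a) (at_right y)"
    using c_continuous[OF assms(2)] assms(1) sub
    by (auto simp: continuous_on_def intro: tendsto_mono)
  have u: "(u \<longlongrightarrow> u y) (at_right y)"
    using u_cont by (auto simp: continuous_on_def intro: tendsto_within_subset)
  have "((\<lambda>z. lam * u z - g z a * s - c z a) \<longlongrightarrow> lam * u y - g y a * s - c y a) (at_right y)"
    by (intro tendsto_intros g c u)
  then have 1: "\<forall>\<^sub>F z in at_right y. lam * u z - g z a * s - c z a > 0"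
    using assms(3) by (rule order_tendstoD)
  have "((\<lambda>z. g z a * g y a) \<longlongrightarrow> g y a * g y a) (at_right y)"
    by (intro tendsto_intros g)
  moreover have "g y a * g y a > 0" using assms(4) by (cases "g y a > 0") (auto simp: zero_less_mult_iff)
  ultimately have 2: "\<forall>\<^sub>F z in at_right y. g z a * g y a > 0"
    by (rule order_tendstoD)
  from eventually_conj[OF 1 2] obtain b where "b > y"
    "\<And>z. y < z \<Longrightarrow> z < b \<Longrightarrow> lam * u z - g z a * s - c z a > 0 \<and> g z a * g y a > 0"
    by (auto simp: eventually_at_right_field)
  then show ?thesis by (intro that[of "b - y"]) auto
qed

lemma slope_ge_near:
  assumes "0 \<le> y" "a \<in> A" "lam * u y - g y a * s - c y a > 0" "g y a > 0"
  obtains \<delta> where "\<delta> > 0" "\<And>z. \<lbrakk>y < z; z < y + \<delta>\<rbrakk> \<Longrightarrow> u z - u y \<ge> s * (z - y)"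
proof -
  obtain \<delta> where \<delta>: "\<delta> > 0" "\<And>z. \<lbrakk>y < z; z < y + \<delta>\<rbrakk> \<Longrightarrow> lam * u z - g z a * s - c z a > 0"
    "\<And>z. \<lbrakk>y < z; z < y + \<delta>\<rbrakk> \<Longrightarrow> g z a * g y a > 0"
    using violation_near[OF assms(1-3)] assms(4) by (metis order_less_irrefl)
  show ?thesis
  proof (rule that[OF \<delta>(1)], rule ccontr)
    fix b assume b: "y < b" "b < y + \<delta>" "\<not> s * (b - y) \<le> u b - u y"
    obtain \<phi> \<phi>' z where z: "C1_on UNIV \<phi> \<phi>'" "y < z" "z < b"
      "local_max_at (\<lambda>y. u y - \<phi> y) z" "\<phi>' z < s"
      by (rule exists_test_slope_less[of y b u s])
         (use b in \<open>auto intro: continuous_on_subset[OF u_cont]\<close>)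
    have "g z a > 0" using \<delta>(3)[of z] z b assms(4) by (auto simp: zero_less_mult_iff)
    then have "g z a * \<phi>' z \<le> g z a * s" using z by simp
    moreover have "lam * u z - g z a * \<phi>' z - c z a \<le> 0"
      using subsolution[OF z(1) _ z(4) assms(2)] z assms(1) by auto
    ultimately show False using \<delta>(2)[of z] z b by auto
  qed
qed

lemma slope_le_near:
  assumes "0 \<le> y" "a \<in> A" "lam * u y - g y a * s - c y a > 0" "g y a < 0"
  obtains \<delta> where "\<delta> > 0" "\<And>z. \<lbrakk>y < z; z < y + \<delta>\<rbrakk> \<Longrightarrow> u z - u y \<le> s * (z - y)"
proof -
  obtain \<delta> where \<delta>: "\<delta> > 0" "\<And>z. \<lbrakk>y < z; z < y + \<delta>\<rbrakk> \<Longrightarrow> lam * u z - g z a * s - c z a > 0"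
    "\<And>z. \<lbrakk>y < z; z < y + \<delta>\<rbrakk> \<Longrightarrow> g z a * g y a > 0"
    using violation_near[OF assms(1-3)] assms(4) by (metis order_less_irrefl)
  show ?thesis
  proof (rule that[OF \<delta>(1)], rule ccontr)
    fix b assume b: "y < b" "b < y + \<delta>" "\<not> u b - u y \<le> s * (b - y)"
    obtain \<phi> \<phi>' z where z: "C1_on UNIV \<phi> \<phi>'" "y < z" "z < b"
      "local_max_at (\<lambda>y. u y - \<phi> y) z" "\<phi>' z > s"
      by (rule exists_test_slope_greater[of y b u s])
         (use b in \<open>auto intro: continuous_on_subset[OF u_cont]\<close>)
    have "g z a < 0" using \<delta>(3)[of z] z b assms(4) by (auto simp: zero_less_mult_iff)
    then have "g z a * \<phi>' z \<le> g z a * s" using z by simp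
    moreover have "lam * u z - g z a * \<phi>' z - c z a \<le> 0"
      using subsolution[OF z(1) _ z(4) assms(2)] z assms(1) by auto
    ultimately show False using \<delta>(2)[of z] z b by auto
  qed
qed

text \<open>The slopes admissible at the endpoint: those \<open>p\<close> with \<open>\<lambda> u(0) + H(0, p) \<le> 0\<close>.\<close>

definition slopes :: "real set" where
  "slopes = {p. \<forall>a\<in>A. lam * u 0 - g 0 a * p - c 0 a \<le> 0}"

text \<open>
  Limits of slopes of test functions at points \<open>z n \<down> 0\<close> are admissible. A control moving to the right and one
  moving to the left bound these slopes from below and above, so that such a limit exists.
\<close>

lemma slopes_nonempty: "slopes \<noteq> {}"
proof -
  obtain am ap where am: "am \<in> A" "g 0 am < 0" and ap: "ap \<in> A" "0 < g 0 ap"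
    using inward outward by blast
  have "\<exists>z q. 0 < z \<and> z < 1 / Suc n \<and> (\<forall>a\<in>A. lam * u z - g z a * q - c z a \<le> 0)" for n
  proof -
    define b :: real where "b = 1 / Suc n"
    have "b > 0" by (simp add: b_def)
    \<comment> \<open>Any slope exceeding the difference quotient would do: only the existence of a test
      function at a point of \<open>(0, b)\<close> is used.\<close>
    obtain \<phi> \<phi>' z where z: "C1_on UNIV \<phi> \<phi>'" "0 < z" "z < b"
      "local_max_at (\<lambda>y. u y - \<phi> y) z"
      by (rule exists_test_slope_less[of 0 b u "(u b - u 0) / b + 1"])
         (use \<open>b > 0\<close> in \<open>auto intro: continuous_on_subset[OF u_cont] simp: field_simps\<close>)
    then show ?thesis using subsolution[OF z(1,2,4)] b_def by blast
  qed
  then obtain z q where zq: "\<And>n. 0 < z n" "\<And>n. z n < 1 / Suc n"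
    "\<And>n a. a \<in> A \<Longrightarrow> lam * u (z n) - g (z n) a * q n - c (z n) a \<le> 0"
    by metis
  have z0: "z \<longlonglongrightarrow> 0"
    by (rule tendsto_sandwich[OF _ _ tendsto_const LIMSEQ_inverse_real_of_nat])
       (use zq(1,2) in \<open>auto simp: inverse_eq_divide less_imp_le intro!: always_eventually\<close>)
  have tg: "(\<lambda>n. g (z n) a) \<longlonglongrightarrow> g 0 a" if "a \<in> A" for a
    by (rule continuous_on_tendsto_compose[OF g_continuous[OF that] z0])
       (use zq in \<open>auto simp: less_imp_le\<close>)
  have tc: "(\<lambda>n. c (z n) a) \<longlonglongrightarrow> c 0 a" if "a \<in> A" for a
    by (rule continuous_on_tendsto_compose[OF c_continuous[OF that] z0])
       (use zq in \<open>auto simp: less_imp_le\<close>)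
  have tu: "(\<lambda>n. u (z n)) \<longlonglongrightarrow> u 0"
    by (rule continuous_on_tendsto_compose[OF u_cont z0]) auto
  \<comment> \<open>Eventually \<open>lo n \<le> q n \<le> hi n\<close>, and \<open>lo\<close> and \<open>hi\<close> converge, so \<open>q\<close> is bounded.\<close>
  define lo where "lo n = (lam * u (z n) - c (z n) ap) / g (z n) ap" for n
  define hi where "hi n = (lam * u (z n) - c (z n) am) / g (z n) am" for n
  have lo: "lo \<longlonglongrightarrow> (lam * u 0 - c 0 ap) / g 0 ap"
    unfolding lo_def using ap by (intro tendsto_intros tg tc tu) auto
  have hi: "hi \<longlonglongrightarrow> (lam * u 0 - c 0 am) / g 0 am"
    unfolding hi_def using am by (intro tendsto_intros tg tc tu) auto
  have "bounded (range lo)" "bounded (range hi)"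
    using lo hi by (auto intro: convergent_imp_bounded)
  then obtain B1 B2 where B: "\<And>n. \<bar>lo n\<bar> \<le> B1" "\<And>n. \<bar>hi n\<bar> \<le> B2"
    unfolding bounded_iff by auto
  have "\<forall>\<^sub>F n in sequentially. 0 < g (z n) ap" "\<forall>\<^sub>F n in sequentially. g (z n) am < 0"
    using order_tendstoD(1)[OF tg[OF ap(1)] ap(2)] order_tendstoD(2)[OF tg[OF am(1)] am(2)] by auto
  then have "\<forall>\<^sub>F n in sequentially. q n \<in> {-B1..B2}"
  proof eventually_elim
    case (elim n)
    have "lo n \<le> q n" using zq(3)[OF ap(1), of n] elim
      by (simp add: lo_def divide_le_eq algebra_simps)
    moreover have "q n \<le> hi n" using zq(3)[OF am(1), of n] elim
      by (simp add: hi_def le_divide_eq algebra_simps)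
    ultimately show ?case using B(1)[of n] B(2)[of n] by auto
  qed
  then obtain N where N: "\<And>n. n \<ge> N \<Longrightarrow> q n \<in> {-B1..B2}"
    by (auto simp: eventually_sequentially)
  have "seq_compact {-B1..B2}" by (simp add: compact_imp_seq_compact compact_Icc)
  then obtain p r where p: "strict_mono r" "((\<lambda>n. q (n + N)) \<circ> r) \<longlonglongrightarrow> p"
    using N seq_compactE[of "{-B1..B2}" "\<lambda>n. q (n + N)"] by (metis le_add2)
  define r' where "r' n = r n + N" for n
  have r': "filterlim r' at_top sequentially"
    unfolding r'_def using filterlim_subseq[OF p(1)]
    by (auto intro!: filterlim_subseq simp: strict_mono_def strict_monoD[OF p(1)])
  have "lam * u 0 - g 0 a * p - c 0 a \<le> 0" if a: "a \<in> A" for a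
  proof (rule LIMSEQ_le_const2)
    show "(\<lambda>n. lam * u (z (r' n)) - g (z (r' n)) a * q (r' n) - c (z (r' n)) a)
            \<longlonglongrightarrow> lam * u 0 - g 0 a * p - c 0 a"
    proof (intro tendsto_intros)
      show "(\<lambda>n. u (z (r' n))) \<longlonglongrightarrow> u 0" by (rule filterlim_compose[OF tu r'])
      show "(\<lambda>n. g (z (r' n)) a) \<longlonglongrightarrow> g 0 a" by (rule filterlim_compose[OF tg[OF a] r'])
      show "(\<lambda>n. c (z (r' n)) a) \<longlonglongrightarrow> c 0 a" by (rule filterlim_compose[OF tc[OF a] r'])
      show "(\<lambda>n. q (r' n)) \<longlonglongrightarrow> p" using p(2) by (simp add: r'_def o_def)
    qed
  qed (use zq(3)[OF a] in auto)
  then show ?thesis by (auto simp: slopes_def)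
qed

lemma slopes_bdd_above: "bdd_above slopes"
proof -
  obtain a where a: "a \<in> A" "g 0 a < 0" using inward by blast
  have "p \<le> (lam * u 0 - c 0 a) / g 0 a" if "p \<in> slopes" for p
    using that a by (auto simp: slopes_def le_divide_eq algebra_simps)
  then show ?thesis unfolding bdd_above_def by blast
qed

lemma Sup_slopes: "Sup slopes \<in> slopes"
proof -
  have "closed slopes"
    unfolding slopes_def Ball_def
    by (intro closed_Collect_all closed_Collect_imp closed_Collect_le continuous_intros open_Collect_const)
  then show ?thesis
    using closed_contains_Sup slopes_nonempty slopes_bdd_above by blast
qed

text \<open>
  Slopes above \<open>Sup slopes\<close> are excluded by a control that moves towards the endpoint: the
  inequality of that control holds at \<open>Sup slopes\<close> and fails at \<open>p\<close>.
\<close>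

lemma below_steep_line:
  assumes "Sup slopes < p"
  obtains \<delta> where "\<delta> > 0" "\<And>z. \<lbrakk>0 \<le> z; z < \<delta>\<rbrakk> \<Longrightarrow> u z \<le> u 0 + p * z"
proof -
  have "p \<notin> slopes" using assms cSup_upper[OF _ slopes_bdd_above] by force
  then obtain a where a: "a \<in> A" "lam * u 0 - g 0 a * p - c 0 a > 0"
    by (auto simp: slopes_def not_le)
  have "lam * u 0 - g 0 a * Sup slopes - c 0 a \<le> 0"
    using Sup_slopes a(1) by (auto simp: slopes_def)
  then have "g 0 a * (p - Sup slopes) < 0" using a(2) by (simp add: algebra_simps)
  then have "g 0 a < 0" using assms by (auto simp: mult_less_0_iff)
  then obtain \<delta> where \<delta>: "\<delta> > 0"
    "\<And>z. \<lbrakk>0 < z; z < 0 + \<delta>\<rbrakk> \<Longrightarrow> u z - u 0 \<le> p * (z - 0)"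
    using slope_le_near[OF order_refl a] by blast
  have "u z \<le> u 0 + p * z" if "0 \<le> z" "z < \<delta>" for z
    using \<delta>(2)[of z] that by (cases "z = 0") auto
  with \<delta>(1) that show ?thesis by blast
qed

end

section \<open>Gluing an affine piece to a subsolution\<close>

context half_line_subsolution
begin

text \<open>
  The function is affine with slope \<open>p\<close> up to \<open>\<epsilon>\<close>, which also extends it to negative arguments, and
  a vertical translate of \<open>u\<close> beyond \<open>\<epsilon>\<close>.
\<close>

definition glued :: "real \<Rightarrow> real \<Rightarrow> real \<Rightarrow> real" where
  "glued p \<epsilon> x = (if x \<le> \<epsilon> then u 0 + p * x else u x + (u 0 + p * \<epsilon> - u \<epsilon>))"

text \<open>The amount by which \<open>glued p \<epsilon>\<close> may violate the equation on \<open>X > - 2 \<epsilon>\<close>.\<close>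

definition defect :: "real \<Rightarrow> real \<Rightarrow> real" where
  "defect p \<epsilon> = lam * \<bar>u 0 + p * \<epsilon> - u \<epsilon>\<bar> + (2 * lam + L) * \<bar>p\<bar> * \<epsilon> + \<omega> \<epsilon>"

lemma glued_continuous: "continuous_on UNIV (glued p \<epsilon>)"
proof -
  have "continuous_on ({..\<epsilon>} \<union> {\<epsilon>..})
      (\<lambda>x. if x \<le> \<epsilon> then u 0 + p * x else u x + (u 0 + p * \<epsilon> - u \<epsilon>))"
    by (rule continuous_on_If)
       (auto intro!: continuous_intros continuous_on_subset[OF u_cont])
  moreover have "{..\<epsilon>} \<union> {\<epsilon>..} = (UNIV :: real set)" by auto
  ultimately show ?thesis unfolding glued_def[abs_def] by simp
qed

lemma defect_nonneg: "0 \<le> \<epsilon> \<Longrightarrow> 0 \<le> defect p \<epsilon>"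
  unfolding defect_def using lam_pos L_nonneg \<omega>_nonneg by (intro add_nonneg_nonneg) auto

text \<open>A parabola touching from above at the right end of an affine piece has at most the slope of that
  piece.\<close>

lemma slope_of_quadratic_bound:
  fixes v :: "real \<Rightarrow> real"
  assumes ev: "\<forall>\<^sub>F z in nhds y. v z \<le> v y + q * (z - y) + K * (z - y)^2"
    and d: "d > 0" "\<And>z. y - d < z \<Longrightarrow> z \<le> y \<Longrightarrow> v z = b + p * z"
  shows "q \<le> p"
proof (rule field_le_epsilon)
  fix e :: real assume "0 < e"
  from ev obtain r where r: "r > 0" "\<And>z. \<bar>z - y\<bar> < r \<Longrightarrow> v z \<le> v y + q * (z - y) + K * (z - y)^2"
    by (auto simp: eventually_nhds_metric dist_real_def)
  define h where "h = min (min (r/2) (d/2)) (e / (\<bar>K\<bar> + 1))"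
  have h: "h > 0" "h < r" "h < d" "h * (\<bar>K\<bar> + 1) \<le> e"
  proof -
    show "h > 0" "h < r" "h < d" using r(1) d(1) \<open>0 < e\<close> by (auto simp: h_def min_less_iff_disj)
    have "h \<le> e / (\<bar>K\<bar> + 1)" by (simp add: h_def)
    then show "h * (\<bar>K\<bar> + 1) \<le> e" by (simp add: field_simps)
  qed
  have "v (y - h) \<le> v y - q * h + K * h^2" using r(2)[of "y - h"] h by simp
  moreover have "v (y - h) = v y - p * h" using d(2)[of "y - h"] d(2)[of y] h d(1) by (simp add: algebra_simps)
  ultimately have "q * h \<le> (p + K * h) * h" by (simp add: power2_eq_square algebra_simps)
  then have "q \<le> p + K * h" using h by simp
  also have "K * h \<le> h * (\<bar>K\<bar> + 1)" using h mult_right_mono[of K "\<bar>K\<bar> + 1" h] by (simp add: mult.commute)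
  finally show "q \<le> p + e" using h by simp
qed

text \<open>
  At the gluing point \<open>\<epsilon>\<close> the slope \<open>q\<close> of a parabola touching from above is at most \<open>p\<close>, which settles
  the controls with \<open>g \<epsilon> a \<le> 0\<close>. For the others, a violation at \<open>q\<close> persists for a slope
  \<open>s > q\<close>, and \<open>u\<close> then grows at least at rate \<open>s\<close> to the right of \<open>\<epsilon>\<close>, contradicting the upper
  bound by the parabola.
\<close>

lemma glued_superjet:
  assumes p: "p \<in> slopes" and \<epsilon>: "0 < \<epsilon>" and y: "- 2 * \<epsilon> < y" and a: "a \<in> A"
    and ev: "\<forall>\<^sub>F z in nhds y. glued p \<epsilon> z \<le> glued p \<epsilon> y + q * (z - y) + K * (z - y)^2"
  shows "lam * glued p \<epsilon> y - g (max y 0) a * q - c (max y 0) a \<le> defect p \<epsilon>"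
proof -
  let ?C = "u 0 + p * \<epsilon> - u \<epsilon>"
  have line: "lam * (u 0 + p * z) - g (max z 0) a * p - c (max z 0) a \<le> defect p \<epsilon>"
    if z: "- 2 * \<epsilon> \<le> z" "z \<le> \<epsilon>" for z
  proof -
    have m: "\<bar>max z 0 - 0\<bar> \<le> \<epsilon>" using z \<epsilon> by auto
    have "\<bar>g (max z 0) a - g 0 a\<bar> \<le> L * \<bar>max z 0 - 0\<bar>" using a by (intro g_Lipschitz) auto
    also have "\<dots> \<le> L * \<epsilon>" using m L_nonneg by (rule mult_left_mono)
    finally have "\<bar>g (max z 0) a - g 0 a\<bar> * \<bar>p\<bar> \<le> L * \<epsilon> * \<bar>p\<bar>" by (rule mult_right_mono) simp
    then have 1: "- g (max z 0) a * p \<le> - g 0 a * p + L * \<epsilon> * \<bar>p\<bar>"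
      by (simp add: abs_mult[symmetric] algebra_simps)
    have "\<bar>c (max z 0) a - c 0 a\<bar> \<le> \<omega> \<bar>max z 0 - 0\<bar>" using a by (intro c_modulus) auto
    also have "\<dots> \<le> \<omega> \<epsilon>" using m \<epsilon> by (intro mono_onD[OF \<omega>_mono]) auto
    finally have 2: "- c (max z 0) a \<le> - c 0 a + \<omega> \<epsilon>" by linarith
    have "p * z \<le> \<bar>p\<bar> * \<bar>z\<bar>" by (metis abs_ge_self abs_mult)
    also have "\<dots> \<le> \<bar>p\<bar> * (2 * \<epsilon>)" using z \<epsilon> by (intro mult_left_mono) auto
    finally have 3: "lam * (p * z) \<le> lam * (\<bar>p\<bar> * (2 * \<epsilon>))" using lam_pos by simp
    have 4: "lam * u 0 - g 0 a * p - c 0 a \<le> 0" using p a by (auto simp: slopes_def)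
    have 5: "0 \<le> lam * \<bar>?C\<bar>" using lam_pos by simp
    have "lam * (u 0 + p * z) - g (max z 0) a * p - c (max z 0) a
        \<le> lam * (\<bar>p\<bar> * (2 * \<epsilon>)) + L * \<epsilon> * \<bar>p\<bar> + \<omega> \<epsilon>"
      using 1 2 3 4 by (simp add: algebra_simps)
    also have "\<dots> \<le> defect p \<epsilon>" unfolding defect_def using 5 by (simp add: algebra_simps)
    finally show ?thesis .
  qed
  have outer: "lam * ?C \<le> defect p \<epsilon>"
  proof -
    have "lam * ?C \<le> lam * \<bar>?C\<bar>" using lam_pos by simp
    moreover have "0 \<le> (2 * lam + L) * \<bar>p\<bar> * \<epsilon> + \<omega> \<epsilon>"
      using lam_pos L_nonneg \<epsilon> \<omega>_nonneg[of \<epsilon>] by simp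
    ultimately show ?thesis by (simp add: defect_def)
  qed
  have q_le: "q \<le> p" if "y \<le> \<epsilon>"
    by (rule slope_of_quadratic_bound[OF ev zero_less_one, of "u 0"]) (use that in \<open>auto simp: glued_def\<close>)
  consider "y < \<epsilon>" | "y > \<epsilon>" | "y = \<epsilon>" by linarith
  then show ?thesis
  proof cases
    case 1
    have "filterlim uminus (nhds (- (- y))) (nhds (- y))" by (intro tendsto_intros filterlim_ident)
    then have "\<forall>\<^sub>F z in nhds (- y). glued p \<epsilon> (- z) \<le> glued p \<epsilon> y + q * (- z - y) + K * (- z - y)^2"
      using ev unfolding filterlim_iff minus_minus by blast
    then have "\<forall>\<^sub>F z in nhds (- y). glued p \<epsilon> (- z) \<le> glued p \<epsilon> (- (- y)) + (- q) * (z - - y) + K * (z - - y)^2"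
      by eventually_elim (simp add: power2_eq_square algebra_simps)
    then have "- q \<le> - p"
      by (rule slope_of_quadratic_bound[of "\<lambda>z. glued p \<epsilon> (- z)" "- y" "- q" K "\<epsilon> - y" "u 0"])
         (use 1 in \<open>auto simp: glued_def\<close>)
    then have "q = p" using q_le 1 by simp
    then show ?thesis using line[of y] 1 y by (simp add: glued_def)
  next
    case 2
    let ?\<phi> = "\<lambda>z. q * (z - y) + K * (z - y)^2"
    have "C1_on UNIV ?\<phi> (\<lambda>z. q + 2 * K * (z - y))"
      unfolding C1_on_def by (auto intro!: derivative_eq_intros continuous_intros)
    moreover have "local_max_at (\<lambda>z. u z - ?\<phi> z) y"
    proof -
      have "\<forall>\<^sub>F z in nhds y. z \<in> {\<epsilon><..}" using 2 by (intro eventually_nhds_in_open) auto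
      with ev show ?thesis unfolding local_max_at_def
        by eventually_elim (use 2 in \<open>auto simp: glued_def\<close>)
    qed
    ultimately have "lam * u y - g y a * (q + 2 * K * (y - y)) - c y a \<le> 0"
      using 2 \<epsilon> a by (intro subsolution) auto
    then show ?thesis using outer 2 \<epsilon> by (simp add: glued_def algebra_simps)
  next
    case 3
    have v: "glued p \<epsilon> y = u \<epsilon> + ?C" "glued p \<epsilon> y = u 0 + p * y" by (auto simp: glued_def 3)
    show ?thesis
    proof (cases "g \<epsilon> a \<le> 0")
      case True
      then have "g \<epsilon> a * p \<le> g \<epsilon> a * q" using q_le 3 by (simp add: mult_left_mono_neg)
      then show ?thesis using line[of y] v 3 \<epsilon> by simp
    next
      case False
      have "lam * u \<epsilon> - g \<epsilon> a * q - c \<epsilon> a \<le> 0"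
      proof (rule ccontr)
        assume "\<not> ?thesis"
        then have pos: "lam * u \<epsilon> - g \<epsilon> a * q - c \<epsilon> a > 0" (is "?P > 0") by simp
        define s where "s = q + ?P / (2 * g \<epsilon> a)"
        have s: "s > q" using pos False by (simp add: s_def)
        have "lam * u \<epsilon> - g \<epsilon> a * s - c \<epsilon> a = ?P / 2"
          using False by (simp add: s_def field_simps)
        then have "lam * u \<epsilon> - g \<epsilon> a * s - c \<epsilon> a > 0" using pos by simp
        then obtain \<delta> where \<delta>: "\<delta> > 0" "\<And>z. \<lbrakk>\<epsilon> < z; z < \<epsilon> + \<delta>\<rbrakk> \<Longrightarrow> u z - u \<epsilon> \<ge> s * (z - \<epsilon>)"
          using slope_ge_near[of \<epsilon> a s thesis] False \<epsilon> a by auto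
        from ev obtain r where r: "r > 0" "\<And>z. \<bar>z - y\<bar> < r \<Longrightarrow>
            glued p \<epsilon> z \<le> glued p \<epsilon> y + q * (z - y) + K * (z - y)^2"
          by (auto simp: eventually_nhds_metric dist_real_def)
        define h where "h = min (min (r/2) (\<delta>/2)) ((s - q) / (2 * (\<bar>K\<bar> + 1)))"
        have h: "h > 0" "h < r" "h < \<delta>" "h * (\<bar>K\<bar> + 1) < s - q"
        proof -
          show "h > 0" "h < r" "h < \<delta>" using r(1) \<delta>(1) s by (auto simp: h_def min_less_iff_disj)
          have "h \<le> (s - q) / (2 * (\<bar>K\<bar> + 1))" by (simp add: h_def)
          then have "h * (\<bar>K\<bar> + 1) \<le> (s - q) / 2" by (simp add: field_simps)
          then show "h * (\<bar>K\<bar> + 1) < s - q" using s by simp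
        qed
        have "u (\<epsilon> + h) - u \<epsilon> \<le> q * h + K * h^2"
          using r(2)[of "\<epsilon> + h"] h v 3 by (simp add: glued_def)
        moreover have "s * h \<le> u (\<epsilon> + h) - u \<epsilon>" using \<delta>(2)[of "\<epsilon> + h"] h by simp
        ultimately have "s * h \<le> (q + K * h) * h" by (simp add: power2_eq_square algebra_simps)
        then have "s - q \<le> K * h" using h by simp
        also have "K * h \<le> h * (\<bar>K\<bar> + 1)" using h mult_right_mono[of K "\<bar>K\<bar> + 1" h] by (simp add: mult.commute)
        finally show False using h by simp
      qed
      then show ?thesis using outer v 3 \<epsilon> by (simp add: algebra_simps)
    qed
  qed
qed

end

section \<open>Sub-optimality along a trajectory\<close>

lemma mono_from_uniform_steps:
  fixes F :: "real \<Rightarrow> real"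
  assumes "0 < \<delta>" "s \<le> t"
    and step: "\<And>r r'. \<lbrakk>s \<le> r; r \<le> r'; r' \<le> t; r' \<le> r + \<delta>\<rbrakk> \<Longrightarrow> F r \<le> F r'"
  shows "F s \<le> F t"
proof -
  have "F s \<le> F r" if "s \<le> r" "r \<le> t" "r \<le> s + real n * \<delta>" for r n
    using that
  proof (induction n arbitrary: r)
    case 0
    then show ?case by simp
  next
    case (Suc n)
    define r0 where "r0 = max s (r - \<delta>)"
    have "F s \<le> F r0"
      using Suc.prems \<open>0 < \<delta>\<close> by (intro Suc.IH) (auto simp: r0_def algebra_simps)
    also have "F r0 \<le> F r"
      using Suc.prems \<open>0 < \<delta>\<close> by (intro step) (auto simp: r0_def)
    finally show ?case .
  qed
  moreover obtain n where "t - s < real n * \<delta>"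
    using reals_Archimedean3[OF \<open>0 < \<delta>\<close>] by blast
  ultimately show ?thesis using assms(2) by (metis diff_le_eq add.commute less_imp_le order_refl)
qed

text \<open>The maximum defining the sup-convolution over a compact interval is attained.\<close>

lemma sup_convolution:
  fixes v :: "real \<Rightarrow> real"
  assumes vc: "continuous_on {b..R} v" and "b \<le> R" "0 < \<sigma>"
  defines "w \<equiv> \<lambda>x. SUP y\<in>{b..R}. v y - (x - y)^2 / (2 * \<sigma>)"
  shows sup_convolution_attained: "\<exists>y\<in>{b..R}. w x = v y - (x - y)^2 / (2 * \<sigma>)"
    and sup_convolution_upper: "y \<in> {b..R} \<Longrightarrow> v y - (x - y)^2 / (2 * \<sigma>) \<le> w x"
proof -
  have "continuous_on {b..R} (\<lambda>y. v y - (x - y)^2 / (2 * \<sigma>))"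
    using \<open>0 < \<sigma>\<close> by (intro continuous_intros vc) auto
  then obtain y where y: "y \<in> {b..R}"
    "\<And>z. z \<in> {b..R} \<Longrightarrow> v z - (x - z)^2 / (2 * \<sigma>) \<le> v y - (x - y)^2 / (2 * \<sigma>)"
    using continuous_attains_sup[of "{b..R}" "\<lambda>y. v y - (x - y)^2 / (2 * \<sigma>)"] \<open>b \<le> R\<close> by auto
  then have "w x = v y - (x - y)^2 / (2 * \<sigma>)"
    unfolding w_def by (intro cSup_eq_maximum) auto
  with y show "\<exists>y\<in>{b..R}. w x = v y - (x - y)^2 / (2 * \<sigma>)"
    "y \<in> {b..R} \<Longrightarrow> v y - (x - y)^2 / (2 * \<sigma>) \<le> w x" for y by auto
qed

lemma set_integral_lower_bound:
  fixes f :: "real \<Rightarrow> real"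
  assumes "r \<le> r'" "set_integrable lebesgue {r<..r'} f" "\<And>\<rho>. \<rho> \<in> {r<..r'} \<Longrightarrow> m \<le> f \<rho>"
  shows "m * (r' - r) \<le> (LINT \<rho>:{r<..r'}|lebesgue. f \<rho>)"
proof -
  have i: "set_integrable lebesgue {r<..r'} (\<lambda>_. m)"
    unfolding set_integrable_def by (intro integrable_scaleR_left integrable_real_indicator) (auto simp: emeasure_lborel_Ioc assms(1))
  have "(LINT \<rho>:{r<..r'}|lebesgue. m) = m * (r' - r)"
    using assms(1) by (simp add: set_lebesgue_integral_def)
  moreover have "(LINT \<rho>:{r<..r'}|lebesgue. m) \<le> (LINT \<rho>:{r<..r'}|lebesgue. f \<rho>)"
    by (rule set_integral_mono[OF i assms(2)]) (use assms(3) in auto)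
  ultimately show ?thesis by simp
qed

lemma set_integral_Ioc_add:
  fixes f :: "real \<Rightarrow> real"
  assumes "s \<le> r" "r \<le> t" "set_integrable lebesgue {s<..t} f"
  shows "(LINT \<rho>:{s<..t}|lebesgue. f \<rho>) = (LINT \<rho>:{s<..r}|lebesgue. f \<rho>) + (LINT \<rho>:{r<..t}|lebesgue. f \<rho>)"
proof -
  have "{s<..t} = {s<..r} \<union> {r<..t}" using assms by auto
  moreover have "set_integrable lebesgue {s<..r} f" "set_integrable lebesgue {r<..t} f"
    using assms by (auto intro: set_integrable_subset)
  ultimately show ?thesis by (simp add: set_integral_Un)
qed

lemma eventually_small_multiple:
  fixes k e :: real
  assumes "0 < e"
  shows "\<forall>\<^sub>F \<delta> in at_right 0. k * \<delta> < e"
proof -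
  have "((\<lambda>\<delta>. k * \<delta>) \<longlongrightarrow> k * 0) (at_right 0)" by (intro tendsto_intros)
  then show ?thesis using assms by (intro order_tendstoD(2)) auto
qed

context half_line_subsolution
begin

lemma M_nonneg: "0 \<le> M"
  using inward g_bound[of 0] by fastforce

text \<open>
  The function \<open>v\<close> satisfies the inequality, up to \<open>\<kappa>\<close>, wherever a parabola touches it from above.
  The trajectory \<open>X\<close> keeps a distance \<open>\<eta>\<close> from the left end \<open>b\<close> of the domain of \<open>v\<close>, so that
  the maximum in the sup-convolution of \<open>v\<close> is attained in the interior.
\<close>

lemma suboptimality:
  fixes v :: "real \<Rightarrow> real"
  assumes vc: "continuous_on {b..} v" and \<kappa>: "0 \<le> \<kappa>"
    and superjet: "\<And>y q K a. \<lbrakk>b < y; a \<in> A; \<forall>\<^sub>F z in nhds y. v z \<le> v y + q * (z - y) + K * (z - y)^2\<rbrakk>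
      \<Longrightarrow> lam * v y - g (max y 0) a * q - c (max y 0) a \<le> \<kappa>"
    and st: "0 \<le> s" "s \<le> t" and \<alpha>: "\<And>\<rho>. \<rho> \<in> {s<..t} \<Longrightarrow> \<alpha> \<rho> \<in> A"
    and Xc: "continuous_on {s..t} X"
    and incr: "\<And>r r'. \<lbrakk>s \<le> r; r \<le> r'; r' \<le> t\<rbrakk> \<Longrightarrow>
      X r' - X r = (LINT \<rho>:{r<..r'}|lebesgue. g (max (X \<rho>) 0) (\<alpha> \<rho>))"
    and gi: "set_integrable lebesgue {s<..t} (\<lambda>\<rho>. g (max (X \<rho>) 0) (\<alpha> \<rho>))"
    and ci: "set_integrable lebesgue {s<..t} (\<lambda>\<rho>. c (max (X \<rho>) 0) (\<alpha> \<rho>) + \<kappa>)"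
    and cei: "set_integrable lebesgue {s<..t} (\<lambda>\<rho>. exp (- lam * \<rho>) * (c (max (X \<rho>) 0) (\<alpha> \<rho>) + \<kappa>))"
    and lower: "0 < \<eta>" "\<And>\<rho>. \<rho> \<in> {s..t} \<Longrightarrow> b + \<eta> \<le> X \<rho>"
  shows "exp (- lam * s) * v (X s) \<le> exp (- lam * t) * v (X t)
    + (LINT \<rho>:{s<..t}|lebesgue. exp (- lam * \<rho>) * (c (max (X \<rho>) 0) (\<alpha> \<rho>) + \<kappa>))"
proof (rule field_le_epsilon)
  fix e0 :: real assume e0: "0 < e0"
  define e where "e = e0 / (1 + (2 * L + 3) * (t - s))"
  have den: "0 < 1 + (2 * L + 3) * (t - s)"
    using L_nonneg st by (intro add_pos_nonneg mult_nonneg_nonneg) auto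
  have e: "0 < e" using e0 den by (simp add: e_def)
  have e_eq: "e + (2 * L + 3) * e * (t - s) = e0"
  proof -
    have "e * (1 + (2 * L + 3) * (t - s)) = e0" using den by (simp add: e_def)
    then show ?thesis by (simp add: algebra_simps)
  qed
  obtain Xm where Xm: "\<And>\<rho>. \<rho> \<in> {s..t} \<Longrightarrow> X \<rho> \<le> Xm"
    using continuous_attains_sup[OF compact_Icc _ Xc] st by force
  define R where "R = Xm + \<eta>"
  have X_in: "b + \<eta> \<le> X \<rho>" "X \<rho> \<le> R - \<eta>" if "\<rho> \<in> {s..t}" for \<rho>
    using lower(2)[OF that] Xm[OF that] by (auto simp: R_def)
  have bR: "b \<le> R" using X_in[of s] st lower(1) by auto
  have vcK: "continuous_on {b..R} v" using vc by (rule continuous_on_subset) auto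
  have "uniformly_continuous_on {b..R} v" using vcK by (intro compact_uniformly_continuous) auto
  then obtain d1 where d1: "0 < d1" "\<And>x y. \<lbrakk>x \<in> {b..R}; y \<in> {b..R}; \<bar>y - x\<bar> < d1\<rbrakk> \<Longrightarrow> \<bar>v y - v x\<bar> < e"
    using e unfolding uniformly_continuous_on_def dist_real_def by metis
  have "\<forall>\<^sub>F r in at_right 0. \<omega> r < e" using order_tendstoD(2)[OF \<omega>_tendsto e] .
  then obtain d2 where d2: "0 < d2" "\<And>r. \<lbrakk>0 < r; r < d2\<rbrakk> \<Longrightarrow> \<omega> r < e"
    by (auto simp: eventually_at_right_field)
  define d where "d = min (d1 / 2) (min (d2 / 4) (\<eta> / 2))"
  have d: "0 < d" "d < d1" "2 * d < d2" "d < \<eta>"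
    using d1(1) d2(1) lower(1) by (auto simp: d_def min_def)
  have \<omega>_small: "\<omega> r \<le> e" if "0 \<le> r" "r \<le> 2 * d" for r
    using mono_onD[OF \<omega>_mono, of r "2 * d"] d2(2)[of "2 * d"] d that by auto
  have "bounded (v ` {b..R})" using vcK by (intro compact_imp_bounded compact_continuous_image) auto
  then obtain B where B: "\<And>y. y \<in> {b..R} \<Longrightarrow> \<bar>v y\<bar> \<le> B"
    unfolding bounded_iff by (metis imageI real_norm_def)
  have B0: "0 \<le> B" using B[of b] bR by auto
  \<comment> \<open>With this parameter the maximisers are at distance at most \<open>d\<close>: there
    \<open>(x - y)\<^sup>2 \<le> 4 \<sigma> B\<close>.\<close>
  define \<sigma> where "\<sigma> = d^2 / (4 * (B + 1))"
  have \<sigma>: "0 < \<sigma>" using d(1) B0 by (simp add: \<sigma>_def)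
  have \<sigma>B: "4 * \<sigma> * B \<le> d^2"
  proof -
    have "4 * \<sigma> * (B + 1) = d^2" using B0 by (simp add: \<sigma>_def field_simps)
    then show ?thesis using \<sigma> by (simp add: algebra_simps)
  qed
  define w where "w x = (SUP y\<in>{b..R}. v y - (x - y)^2 / (2 * \<sigma>))" for x
  note w_att = sup_convolution_attained[OF vcK bR \<sigma>, folded w_def]
  note w_upper = sup_convolution_upper[OF vcK bR \<sigma>, folded w_def]
  \<comment> \<open>The bound on \<open>(x - y)\<^sup>2 / \<sigma>\<close> controls the slope times the distance, hence the effect of
    evaluating the dynamics at \<open>x\<close> instead of \<open>y\<close>.\<close>
  have prox: "\<exists>y. b < y \<and> y < R \<and> w x = v y - (x - y)^2 / (2 * \<sigma>) \<and> \<bar>x - y\<bar> \<le> d \<and> (x - y)^2 / \<sigma> \<le> 2 * e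
      \<and> v x \<le> w x \<and> w x \<le> v y \<and> w x \<le> v x + e \<and> \<bar>w x\<bar> \<le> B"
    if x: "b + \<eta> \<le> x" "x \<le> R - \<eta>" for x
  proof -
    obtain y where y: "y \<in> {b..R}" "w x = v y - (x - y)^2 / (2 * \<sigma>)" using w_att by blast
    have xK: "x \<in> {b..R}" using x lower(1) by auto
    have vw: "v x \<le> w x" using w_upper[of x x] xK by simp
    have wv: "w x \<le> v y" using y \<sigma> by simp
    have gap: "(x - y)^2 / (2 * \<sigma>) \<le> v y - v x" using y vw by simp
    also have "\<dots> \<le> 2 * B" using B[OF y(1)] B[OF xK] by linarith
    finally have "(x - y)^2 \<le> 4 * \<sigma> * B" using \<sigma> by (simp add: field_simps)
    then have "(x - y)^2 \<le> d^2" using \<sigma>B by linarith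
    then have xy: "\<bar>x - y\<bar> \<le> d" using d(1) abs_le_square_iff[of "x - y" d] by simp
    then have ve: "\<bar>v y - v x\<bar> < e" using d1(2)[OF xK y(1)] d by (auto simp: abs_minus_commute)
    have "(x - y)^2 / \<sigma> = 2 * ((x - y)^2 / (2 * \<sigma>))" by simp
    then have "(x - y)^2 / \<sigma> \<le> 2 * e" using gap ve by linarith
    moreover have "\<bar>w x\<bar> \<le> B" using vw wv B[OF y(1)] B[OF xK] by linarith
    ultimately show ?thesis
      using y xy vw wv ve x d by (intro exI[of _ y]) auto
  qed
  obtain \<delta> where \<delta>: "0 < \<delta>" "lam * \<delta> < 1" "M * \<delta> < d" "(L * (d / \<sigma>) * M) * \<delta> < e"
    "(B * lam^2 + M^2 / (2 * \<sigma>)) * \<delta> < e"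
  proof -
    have "\<forall>\<^sub>F \<delta> in at_right 0. 0 < \<delta> \<and> lam * \<delta> < 1 \<and> M * \<delta> < d \<and> (L * (d / \<sigma>) * M) * \<delta> < e
      \<and> (B * lam^2 + M^2 / (2 * \<sigma>)) * \<delta> < e"
      using d(1) e by (intro eventually_conj eventually_small_multiple eventually_at_right_less) auto
    then show ?thesis using that eventually_happens'[OF trivial_limit_at_right_real] by blast
  qed
  have int_sub: "set_integrable lebesgue {r<..r'} F"
    if "set_integrable lebesgue {s<..t} F" "s \<le> r" "r' \<le> t" for r r' and F :: "real \<Rightarrow> real"
    using that by (auto intro!: set_integrable_subset[OF that(1)])
  have X_Lip: "\<bar>X r' - X r\<bar> \<le> M * (r' - r)" if r: "s \<le> r" "r \<le> r'" "r' \<le> t" for r r'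
  proof -
    have bd: "- M \<le> g (max (X \<rho>) 0) (\<alpha> \<rho>)" "g (max (X \<rho>) 0) (\<alpha> \<rho>) \<le> M" if "\<rho> \<in> {r<..r'}" for \<rho>
      using g_bound[of "max (X \<rho>) 0" "\<alpha> \<rho>"] \<alpha>[of \<rho>] that r by auto
    have "(- M) * (r' - r) \<le> X r' - X r" unfolding incr[OF r]
      by (rule set_integral_lower_bound[OF r(2) int_sub[OF gi r(1,3)]]) (rule bd)
    moreover have "(- M) * (r' - r) \<le> (LINT \<rho>:{r<..r'}|lebesgue. - g (max (X \<rho>) 0) (\<alpha> \<rho>))"
      by (rule set_integral_lower_bound[OF r(2)])
         (use bd int_sub[OF gi r(1,3)] in \<open>auto simp: set_integrable_def\<close>)
    ultimately show ?thesis
      using incr[OF r] by (simp add: set_lebesgue_integral_def abs_le_iff)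
  qed
  define \<Phi> where "\<Phi> r = exp (- lam * r) * w (X r)
    + (LINT \<rho>:{s<..r}|lebesgue. exp (- lam * \<rho>) * (c (max (X \<rho>) 0) (\<alpha> \<rho>) + \<kappa>)) + (2 * L + 3) * e * r" for r
  have "\<Phi> s \<le> \<Phi> t"
  proof (rule mono_from_uniform_steps[OF \<delta>(1) st(2)])
    fix r r' assume r: "s \<le> r" "r \<le> r'" "r' \<le> t" and near: "r' \<le> r + \<delta>"
    define h where "h = r' - r"
    have h: "0 \<le> h" "h \<le> \<delta>" using r near by (auto simp: h_def)
    define x where "x = X r"
    obtain y where y: "b < y" "y < R" "w x = v y - (x - y)^2 / (2 * \<sigma>)" "\<bar>x - y\<bar> \<le> d"
        "(x - y)^2 / \<sigma> \<le> 2 * e" "w x \<le> v y" "\<bar>w x\<bar> \<le> B"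
      using prox[of x] X_in[of r] r by (auto simp: x_def)
    define q where "q = (y - x) / \<sigma>"
    have jet: "lam * v y \<le> g (max y 0) a * q + c (max y 0) a + \<kappa>" if "a \<in> A" for a
    proof -
      have "\<forall>\<^sub>F z in nhds y. z \<in> {b<..<R}" using y by (intro eventually_nhds_in_open) auto
      then have "\<forall>\<^sub>F z in nhds y. v z \<le> v y + q * (z - y) + 1 / (2 * \<sigma>) * (z - y)^2"
      proof eventually_elim
        case (elim z)
        have "v z - (x - z)^2 / (2 * \<sigma>) \<le> v y - (x - y)^2 / (2 * \<sigma>)"
          using w_upper[of z x] elim y(3) by auto
        moreover have "(x - z)^2 / (2 * \<sigma>) - (x - y)^2 / (2 * \<sigma>) = q * (z - y) + 1 / (2 * \<sigma>) * (z - y)^2"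
          using \<sigma> by (simp add: q_def field_simps power2_eq_square)
        ultimately show ?case by linarith
      qed
      from superjet[OF y(1) that this] show ?thesis by linarith
    qed
    define G where "G \<rho> = g (max (X \<rho>) 0) (\<alpha> \<rho>)" for \<rho>
    define C where "C \<rho> = c (max (X \<rho>) 0) (\<alpha> \<rho>) + \<kappa>" for \<rho>
    have Gi: "set_integrable lebesgue {r<..r'} G" and Ci: "set_integrable lebesgue {r<..r'} C"
      and Cei: "set_integrable lebesgue {r<..r'} (\<lambda>\<rho>. exp (- lam * \<rho>) * C \<rho>)"
      using int_sub[OF gi r(1,3)] int_sub[OF ci r(1,3)] int_sub[OF cei r(1,3)] by (simp_all add: G_def[abs_def] C_def[abs_def])
    define J where "J = (LINT \<rho>:{r<..r'}|lebesgue. C \<rho>)"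
    define \<Delta> where "\<Delta> = X r' - x"
    have \<Delta>: "\<Delta> = (LINT \<rho>:{r<..r'}|lebesgue. G \<rho>)" using incr[OF r] by (simp add: \<Delta>_def x_def G_def)
    \<comment> \<open>The inequality at \<open>y\<close>, used with the control active at time \<open>\<rho>\<close> and moved to \<open>X \<rho>\<close>.\<close>
    have pointwise: "lam * w x - (2 * L + 2) * e \<le> q * G \<rho> + C \<rho>" if \<rho>: "\<rho> \<in> {r<..r'}" for \<rho>
    proof -
      have a: "\<alpha> \<rho> \<in> A" using \<rho> r by (intro \<alpha>) auto
      have "\<bar>X \<rho> - x\<bar> \<le> M * (\<rho> - r)" unfolding x_def using \<rho> r by (intro X_Lip) auto
      also have "\<dots> \<le> M * h" using \<rho> M_nonneg by (intro mult_left_mono) (auto simp: h_def)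
      finally have X\<rho>: "\<bar>X \<rho> - x\<bar> \<le> M * h" .
      have Mh: "M * h \<le> M * \<delta>" using h M_nonneg by (intro mult_left_mono) auto
      have dist: "\<bar>max y 0 - max (X \<rho>) 0\<bar> \<le> \<bar>x - y\<bar> + M * h" using X\<rho> by linarith
      have "\<bar>g (max y 0) (\<alpha> \<rho>) - G \<rho>\<bar> \<le> L * \<bar>max y 0 - max (X \<rho>) 0\<bar>"
        unfolding G_def by (intro g_Lipschitz a) auto
      also have "\<dots> \<le> L * (\<bar>x - y\<bar> + M * h)" using dist L_nonneg by (rule mult_left_mono)
      finally have "\<bar>g (max y 0) (\<alpha> \<rho>) - G \<rho>\<bar> * \<bar>q\<bar> \<le> L * (\<bar>x - y\<bar> + M * h) * \<bar>q\<bar>"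
        by (rule mult_right_mono) simp
      also have "\<dots> = L * (\<bar>x - y\<bar> * \<bar>q\<bar>) + L * \<bar>q\<bar> * M * h" by (simp add: algebra_simps)
      also have "\<bar>x - y\<bar> * \<bar>q\<bar> = (x - y)^2 / \<sigma>"
        using \<sigma> by (simp add: q_def abs_minus_commute power2_eq_square flip: abs_mult)
      also have "L * ((x - y)^2 / \<sigma>) \<le> L * (2 * e)" using y(5) L_nonneg by (rule mult_left_mono)
      also have "L * \<bar>q\<bar> * M * h \<le> e"
      proof -
        have "\<bar>q\<bar> \<le> d / \<sigma>" using y(4) \<sigma> by (simp add: q_def divide_right_mono abs_minus_commute)
        then have "L * \<bar>q\<bar> * M * h \<le> L * (d / \<sigma>) * M * \<delta>"
          using L_nonneg M_nonneg h d(1) \<sigma> by (intro mult_mono mult_nonneg_nonneg) auto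
        then show ?thesis using \<delta>(4) by simp
      qed
      finally have "\<bar>g (max y 0) (\<alpha> \<rho>) - G \<rho>\<bar> * \<bar>q\<bar> \<le> 2 * L * e + e" by simp
      then have 1: "g (max y 0) (\<alpha> \<rho>) * q \<le> q * G \<rho> + 2 * L * e + e"
        by (simp add: abs_mult[symmetric] algebra_simps)
      have "\<bar>c (max y 0) (\<alpha> \<rho>) - c (max (X \<rho>) 0) (\<alpha> \<rho>)\<bar> \<le> \<omega> \<bar>max y 0 - max (X \<rho>) 0\<bar>"
        by (intro c_modulus a) auto
      also have "\<dots> \<le> e" using dist y(4) Mh \<delta>(3) by (intro \<omega>_small) auto
      finally have 2: "c (max y 0) (\<alpha> \<rho>) + \<kappa> \<le> C \<rho> + e" unfolding C_def by linarith
      have "lam * w x \<le> lam * v y" using y(6) lam_pos by simp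
      then show ?thesis using jet[OF a] 1 2 by (simp add: algebra_simps)
    qed
    have "(lam * w x - (2 * L + 2) * e) * (r' - r) \<le> (LINT \<rho>:{r<..r'}|lebesgue. q * G \<rho> + C \<rho>)"
      by (rule set_integral_lower_bound[OF r(2) _ pointwise]) (use Gi Ci in auto)
    also have "\<dots> = q * \<Delta> + J"
      using Gi Ci by (simp add: \<Delta> J_def set_integral_add)
    finally have main: "(lam * w x - (2 * L + 2) * e) * h \<le> q * \<Delta> + J" by (simp add: h_def)
    \<comment> \<open>Keeping the maximiser \<open>y\<close> of \<open>x\<close> as a competitor at \<open>X r'\<close> gives the parabola from below.\<close>
    have "w x + q * \<Delta> - \<Delta>^2 / (2 * \<sigma>) = v y - (X r' - y)^2 / (2 * \<sigma>)"
      using \<sigma> unfolding y(3) q_def \<Delta>_def by (simp add: field_simps power2_eq_square)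
    also have "\<dots> \<le> w (X r')" using y by (intro w_upper) auto
    finally have semi: "w x + q * \<Delta> - \<Delta>^2 / (2 * \<sigma>) \<le> w (X r')" .
    have "\<bar>\<Delta>\<bar> \<le> \<bar>M * h\<bar>" using X_Lip[OF r] by (simp add: \<Delta>_def x_def h_def)
    then have "\<Delta>^2 \<le> M^2 * h^2" by (simp add: abs_le_square_iff power_mult_distrib)
    then have quad: "\<Delta>^2 / (2 * \<sigma>) \<le> M^2 / (2 * \<sigma>) * h^2" using \<sigma> by (simp add: field_simps)
    have lh: "0 \<le> lam * h" "lam * h \<le> 1"
    proof -
      show "0 \<le> lam * h" using lam_pos h by simp
      have "lam * h \<le> lam * \<delta>" using h(2) lam_pos by (intro mult_left_mono) auto
      then show "lam * h \<le> 1" using \<delta>(2) by linarith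
    qed
    have "(exp (lam * h) - 1 - lam * h) * w x \<le> (lam * h)^2 * B"
    proof -
      have "exp (lam * h) \<le> 1 + lam * h + (lam * h)^2" using lh by (rule exp_bound)
      moreover have "0 \<le> exp (lam * h) - 1 - lam * h" using exp_ge_add_one_self[of "lam * h"] by linarith
      ultimately have "(exp (lam * h) - 1 - lam * h) * \<bar>w x\<bar> \<le> (lam * h)^2 * B"
        using y(7) by (intro mult_mono) auto
      moreover have "(exp (lam * h) - 1 - lam * h) * w x \<le> (exp (lam * h) - 1 - lam * h) * \<bar>w x\<bar>"
        using \<open>0 \<le> exp (lam * h) - 1 - lam * h\<close> by (intro mult_left_mono) auto
      ultimately show ?thesis by linarith
    qed
    then have expo: "exp (lam * h) * w x \<le> w x + lam * h * w x + B * lam^2 * h^2"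
      by (simp add: algebra_simps power_mult_distrib)
    have "(B * lam^2 + M^2 / (2 * \<sigma>)) * h \<le> e"
      using \<delta>(5) mult_left_mono[OF h(2), of "B * lam^2 + M^2 / (2 * \<sigma>)"] B0 \<sigma> by auto
    then have "(B * lam^2 + M^2 / (2 * \<sigma>)) * h * h \<le> e * h" using h(1) by (rule mult_right_mono)
    then have small: "B * lam^2 * h^2 + M^2 / (2 * \<sigma>) * h^2 \<le> e * h"
      by (simp add: power2_eq_square algebra_simps)
    have bracket: "- ((2 * L + 3) * e * h) \<le> w (X r') - exp (lam * h) * w x + J"
      using main semi quad expo small by (simp add: algebra_simps)
    have "exp (- lam * r') * J = (LINT \<rho>:{r<..r'}|lebesgue. exp (- lam * r') * C \<rho>)"
      by (simp add: J_def)
    also have "\<dots> \<le> (LINT \<rho>:{r<..r'}|lebesgue. exp (- lam * \<rho>) * C \<rho>)"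
    proof (rule set_integral_mono[OF _ Cei])
      show "set_integrable lebesgue {r<..r'} (\<lambda>\<rho>. exp (- lam * r') * C \<rho>)" using Ci by simp
      fix \<rho> assume \<rho>: "\<rho> \<in> {r<..r'}"
      then have "0 \<le> C \<rho>" unfolding C_def using r \<kappa> by (intro add_nonneg_nonneg c_nonneg \<alpha>) auto
      then show "exp (- lam * r') * C \<rho> \<le> exp (- lam * \<rho>) * C \<rho>"
        using \<rho> lam_pos by (intro mult_right_mono) auto
    qed
    finally have J: "exp (- lam * r') * J \<le> (LINT \<rho>:{r<..r'}|lebesgue. exp (- lam * \<rho>) * C \<rho>)" .
    have "exp (- lam * r') \<le> 1" using lam_pos st r by simp
    define N where "N = (2 * L + 3) * e * h"
    have "0 \<le> N" unfolding N_def using L_nonneg e h by (intro mult_nonneg_nonneg) auto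
    with \<open>exp (- lam * r') \<le> 1\<close> have "exp (- lam * r') * N \<le> N" by (rule mult_left_le_one_le[rotated 2]) simp
    moreover have "exp (- lam * r') * (- N) \<le> exp (- lam * r') * (w (X r') - exp (lam * h) * w x + J)"
      using bracket unfolding N_def by (rule mult_left_mono) simp
    moreover have "exp (- lam * r') * (exp (lam * h) * w x) = exp (- lam * r) * w x"
      unfolding h_def mult.assoc[symmetric] exp_add[symmetric] by (simp add: algebra_simps)
    ultimately have "exp (- lam * r) * w x \<le> exp (- lam * r') * w (X r') + exp (- lam * r') * J + N"
      unfolding distrib_left right_diff_distrib mult_minus_right by linarith
    then have "exp (- lam * r) * w x \<le> exp (- lam * r') * w (X r')
        + (LINT \<rho>:{r<..r'}|lebesgue. exp (- lam * \<rho>) * C \<rho>) + N"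
      using J by linarith
    moreover have "(LINT \<rho>:{s<..r'}|lebesgue. exp (- lam * \<rho>) * C \<rho>)
       = (LINT \<rho>:{s<..r}|lebesgue. exp (- lam * \<rho>) * C \<rho>) + (LINT \<rho>:{r<..r'}|lebesgue. exp (- lam * \<rho>) * C \<rho>)"
      using int_sub[OF cei order_refl r(3)] r by (intro set_integral_Ioc_add) (auto simp: C_def[abs_def])
    moreover have "N = (2 * L + 3) * e * r' - (2 * L + 3) * e * r"
      by (simp add: N_def h_def algebra_simps)
    ultimately show "\<Phi> r \<le> \<Phi> r'" unfolding \<Phi>_def x_def C_def by linarith
  qed
  then have "exp (- lam * s) * w (X s) \<le> exp (- lam * t) * w (X t)
      + (LINT \<rho>:{s<..t}|lebesgue. exp (- lam * \<rho>) * (c (max (X \<rho>) 0) (\<alpha> \<rho>) + \<kappa>)) + (2 * L + 3) * e * (t - s)"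
    by (simp add: \<Phi>_def set_lebesgue_integral_def algebra_simps)
  moreover have "exp (- lam * s) * v (X s) \<le> exp (- lam * s) * w (X s)"
    using prox[of "X s"] X_in[of s] st by (intro mult_left_mono) auto
  moreover have "exp (- lam * t) * w (X t) \<le> exp (- lam * t) * v (X t) + e"
  proof -
    have "w (X t) \<le> v (X t) + e" using prox[of "X t"] X_in[of t] st by auto
    then have "exp (- lam * t) * w (X t) \<le> exp (- lam * t) * (v (X t) + e)" by (rule mult_left_mono) simp
    moreover have "exp (- lam * t) * e \<le> 1 * e" using lam_pos st e by (intro mult_right_mono) auto
    ultimately show ?thesis by (simp add: algebra_simps)
  qed
  ultimately show "exp (- lam * s) * v (X s) \<le> exp (- lam * t) * v (X t)
    + (LINT \<rho>:{s<..t}|lebesgue. exp (- lam * \<rho>) * (c (max (X \<rho>) 0) (\<alpha> \<rho>) + \<kappa>)) + e0"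
    using e_eq by linarith
qed

end

section \<open>Measurability along trajectories\<close>

text \<open>
  The control set carries only a topology, so joint measurability of \<open>F\<close> is not at hand; rounding
  the state to multiples of \<open>1 / (n + 1)\<close> reduces the claim to countably many state values.
\<close>

lemma caratheodory_measurable:
  fixes F :: "real \<Rightarrow> 'a::topological_space \<Rightarrow> real"
  assumes \<alpha>: "\<alpha> \<in> controls A" and X: "continuous_on {0..} X"
    and F_cont: "\<And>x. continuous_on A (F x)"
    and F_mod: "\<And>x y a. a \<in> A \<Longrightarrow> \<bar>F x a - F y a\<bar> \<le> \<omega> \<bar>x - y\<bar>"
    and \<omega>: "continuous_on {0..} \<omega>" "\<omega> 0 = 0"
  shows "(\<lambda>t. F (X t) (\<alpha> t)) \<in> borel_measurable (lebesgue_on {0..})"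
proof (rule borel_measurable_LIMSEQ_real)
  define Y where "Y n t = of_int \<lfloor>(real n + 1) * X t\<rfloor> / (real n + 1)" for n t
  have X_meas: "X \<in> borel_measurable (lebesgue_on {0..})"
    using X by (rule continuous_imp_measurable_on_sets_lebesgue) auto
  have \<alpha>A: "\<alpha> \<in> measurable (lebesgue_on {0..}) (restrict_space borel A)"
    using \<alpha> by (intro measurable_restrict_space2) (auto simp: controls_def space_restrict_space)
  have F_meas: "(\<lambda>t. F x (\<alpha> t)) \<in> borel_measurable (lebesgue_on {0..})" for x
    using measurable_compose[OF \<alpha>A borel_measurable_continuous_on_restrict[OF F_cont]] .
  show "(\<lambda>t. F (Y n t) (\<alpha> t)) \<in> borel_measurable (lebesgue_on {0..})" for n
  proof -
    have "(\<lambda>t. \<lfloor>(real n + 1) * X t\<rfloor>) \<in> measurable (lebesgue_on {0..}) (count_space UNIV)"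
      using X_meas by measurable
    from measurable_compose_countable[OF F_meas this, of "\<lambda>k. of_int k / (real n + 1)"]
    show ?thesis by (simp add: Y_def)
  qed
  fix t :: real assume "t \<in> space (lebesgue_on {0..})"
  then have t: "0 \<le> t" by (simp add: space_restrict_space)
  have dist: "\<bar>Y n t - X t\<bar> \<le> 1 / (real n + 1)" for n
  proof -
    have "Y n t - X t = (of_int \<lfloor>(real n + 1) * X t\<rfloor> - (real n + 1) * X t) / (real n + 1)"
      by (simp add: Y_def diff_divide_distrib)
    moreover have "\<bar>of_int \<lfloor>(real n + 1) * X t\<rfloor> - (real n + 1) * X t\<bar> \<le> 1" by linarith
    ultimately show ?thesis by (simp add: divide_right_mono)
  qed
  have "(\<lambda>n. Y n t - X t) \<longlonglongrightarrow> 0"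
    by (rule Lim_null_comparison[OF _ LIMSEQ_inverse_real_of_nat])
       (use dist in \<open>auto simp: inverse_eq_divide add.commute\<close>)
  then have "(\<lambda>n. \<bar>Y n t - X t\<bar>) \<longlonglongrightarrow> 0" by (rule tendsto_rabs_zero)
  then have "(\<lambda>n. \<omega> \<bar>Y n t - X t\<bar>) \<longlonglongrightarrow> \<omega> 0"
    by (intro continuous_on_tendsto_compose[OF \<omega>(1)]) auto
  then have "(\<lambda>n. \<omega> \<bar>Y n t - X t\<bar>) \<longlonglongrightarrow> 0" by (simp add: \<omega>(2))
  then have "(\<lambda>n. F (Y n t) (\<alpha> t) - F (X t) (\<alpha> t)) \<longlonglongrightarrow> 0"
    by (rule Lim_null_comparison[rotated])
       (use \<alpha> t in \<open>auto simp: controls_def intro!: F_mod always_eventually\<close>)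
  then show "(\<lambda>n. F (Y n t) (\<alpha> t)) \<longlonglongrightarrow> F (X t) (\<alpha> t)" by (rule LIM_zero_cancel)
qed

section \<open>The delayed relay\<close>

lemma thermostatD:
  assumes "thermostat \<epsilon> v i0 i"
  shows thermostat_continuous: "continuous_on {0..} v"
    and thermostat_initial: "i 0 = i0"
    and thermostat_range: "0 \<le> t \<Longrightarrow> i t = 1 \<or> i t = - 1"
    and thermostat_low: "\<lbrakk>0 \<le> t; v t < - \<epsilon>\<rbrakk> \<Longrightarrow> i t = - 1"
    and thermostat_high: "\<lbrakk>0 \<le> t; \<epsilon> < v t\<rbrakk> \<Longrightarrow> i t = 1"
    and thermostat_stay_high:
      "\<lbrakk>0 \<le> s; s \<le> t; i s = 1; \<And>r. r \<in> {s..t} \<Longrightarrow> - \<epsilon> \<le> v r\<rbrakk> \<Longrightarrow> i t = 1"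
    and thermostat_stay_low:
      "\<lbrakk>0 \<le> s; s \<le> t; i s = - 1; \<And>r. r \<in> {s..t} \<Longrightarrow> v r \<le> \<epsilon>\<rbrakk> \<Longrightarrow> i t = - 1"
  using assms unfolding thermostat_def by blast+

lemma thermostat_uminus:
  assumes th: "thermostat \<epsilon> v i0 i"
  shows "thermostat \<epsilon> (\<lambda>t. - v t) (- i0) (\<lambda>t. - i t)"
proof -
  have eq: "(- k = 1) = (k = -1)" "(- k = -1) = (k = 1)" for k :: int by auto
  show ?thesis unfolding thermostat_def eq
  proof (intro conjI allI impI; (elim conjE)?)
    show "continuous_on {0..} (\<lambda>t. - v t)"
      using thermostat_continuous[OF th] by (rule continuous_on_minus)
    show "- i 0 = - i0" using thermostat_initial[OF th] by simp
    show "- i t \<in> {1, - 1}" if "0 \<le> t" for t using thermostat_range[OF th that] by auto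
    show "i t = 1" if "0 \<le> t" "- v t < - \<epsilon>" for t using thermostat_high[OF th that(1)] that(2) by simp
    show "i t = - 1" if "0 \<le> t" "\<epsilon> < - v t" for t using thermostat_low[OF th that(1)] that(2) by simp
    show "i t = - 1" if "0 \<le> s" "s \<le> t" "i s = - 1" "\<forall>r\<in>{s..t}. - \<epsilon> \<le> - v r" for s t
      by (rule thermostat_stay_low[OF th that(1-3)]) (use that(4) in auto)
    show "i t = 1" if "0 \<le> s" "s \<le> t" "i s = 1" "\<forall>r\<in>{s..t}. - v r \<le> \<epsilon>" for s t
      by (rule thermostat_stay_high[OF th that(1-3)]) (use that(4) in force)
  qed
qed

text \<open>
  While the input oscillates by at most \<open>\<epsilon>\<close>, the output switches at most once: after passing one
  threshold the input cannot pass the other one.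
\<close>

lemma thermostat_one_switch_aux:
  assumes th: "thermostat \<epsilon> v i0 i" and st: "0 \<le> s" "s \<le> t"
    and osc: "\<And>r r'. \<lbrakk>r \<in> {s..t}; r' \<in> {s..t}\<rbrakk> \<Longrightarrow> \<bar>v r - v r'\<bar> \<le> \<epsilon>"
    and is1: "i s = 1"
  shows "(\<forall>r\<in>{s..t}. i r = 1) \<or>
    (\<exists>r\<in>{s..t}. v r = - \<epsilon> \<and> (\<forall>\<rho>\<in>{s..r}. i \<rho> = 1) \<and> (\<forall>\<rho>\<in>{r<..t}. i \<rho> = - 1))"
proof (cases "\<forall>r\<in>{s..t}. - \<epsilon> \<le> v r")
  case True
  have "i r = 1" if "r \<in> {s..t}" for r
    by (rule thermostat_stay_high[OF th st(1) _ is1]) (use True that in auto)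
  then show ?thesis by blast
next
  case False
  define S where "S = {r \<in> {s..t}. v r < - \<epsilon>}"
  define r where "r = Inf S"
  have S: "S \<noteq> {}" using False by (force simp: S_def)
  have bdd: "bdd_below S" by (auto simp: S_def bdd_below_def)
  have r_le: "r \<le> \<rho>" if "\<rho> \<in> S" for \<rho> using cInf_lower[OF that bdd] by (simp add: r_def)
  have r_in: "s \<le> r" "r \<le> t"
    using cInf_greatest[OF S, of s] r_le S by (force simp: r_def S_def)+
  have above: "- \<epsilon> \<le> v \<rho>" if "s \<le> \<rho>" "\<rho> < r" for \<rho>
    using r_le[of \<rho>] that r_in by (force simp: S_def)
  have vs: "- \<epsilon> \<le> v s"
    using thermostat_low[OF th st(1)] is1 by fastforce
  have lim: "(v \<longlongrightarrow> v r) (at r within {0..})"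
    using thermostat_continuous[OF th] st r_in by (auto simp: continuous_on_def)
  have "\<not> v r < - \<epsilon>"
  proof
    assume *: "v r < - \<epsilon>"
    then have "s < r" using vs r_in by (metis not_le order_le_less)
    obtain d where d: "d > 0" "\<And>\<rho>. \<lbrakk>0 \<le> \<rho>; \<rho> \<noteq> r; \<bar>\<rho> - r\<bar> < d\<rbrakk> \<Longrightarrow> v \<rho> < - \<epsilon>"
      using order_tendstoD(2)[OF lim *] by (auto simp: eventually_at dist_real_def)
    have "v (max s (r - d / 2)) < - \<epsilon>" using d(1) \<open>s < r\<close> st by (intro d(2)) auto
    moreover have "- \<epsilon> \<le> v (max s (r - d / 2))" using d(1) \<open>s < r\<close> by (intro above) auto
    ultimately show False by simp
  qed
  moreover have "\<not> v r > - \<epsilon>"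
  proof
    assume *: "v r > - \<epsilon>"
    obtain d where d: "d > 0" "\<And>\<rho>. \<lbrakk>0 \<le> \<rho>; \<rho> \<noteq> r; \<bar>\<rho> - r\<bar> < d\<rbrakk> \<Longrightarrow> v \<rho> > - \<epsilon>"
      using order_tendstoD(1)[OF lim *] by (auto simp: eventually_at dist_real_def)
    have "r + d \<le> \<rho>" if "\<rho> \<in> S" for \<rho>
    proof (rule ccontr)
      assume "\<not> r + d \<le> \<rho>"
      then have "v \<rho> > - \<epsilon>"
        using d(2)[of \<rho>] r_le[OF that] that st * by (cases "\<rho> = r") (auto simp: S_def)
      with that show False by (simp add: S_def)
    qed
    then have "r + d \<le> Inf S" by (intro cInf_greatest[OF S])
    with d(1) show False by (simp add: r_def)
  qed
  ultimately have vr: "v r = - \<epsilon>" by simp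
  have "i \<rho> = 1" if "\<rho> \<in> {s..r}" for \<rho>
  proof -
    have "- \<epsilon> \<le> v \<rho>'" if "\<rho>' \<in> {s..\<rho>}" for \<rho>'
      using above[of \<rho>'] vr that \<open>\<rho> \<in> {s..r}\<close> by (cases "\<rho>' = r") auto
    then show ?thesis
      using that by (intro thermostat_stay_high[OF th st(1) _ is1]) auto
  qed
  moreover have "i \<rho> = - 1" if \<rho>: "\<rho> \<in> {r<..t}" for \<rho>
  proof -
    obtain \<rho>' where \<rho>': "\<rho>' \<in> S" "\<rho>' < \<rho>"
      using cInf_lessD[OF S] \<rho> unfolding r_def by (metis greaterThanAtMost_iff)
    then have "0 \<le> \<rho>'" "v \<rho>' < - \<epsilon>" using st by (auto simp: S_def)
    then have "i \<rho>' = - 1" by (rule thermostat_low[OF th])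
    moreover have "v \<tau> \<le> \<epsilon>" if "\<tau> \<in> {\<rho>'..\<rho>}" for \<tau>
    proof -
      have "\<bar>v \<tau> - v r\<bar> \<le> \<epsilon>" using that \<rho> r_in r_le[OF \<rho>'(1)] by (intro osc) auto
      moreover have "0 \<le> \<epsilon>" using osc[of s s] st by simp
      ultimately show ?thesis using vr by linarith
    qed
    ultimately show ?thesis
      using \<rho>'(2) \<open>0 \<le> \<rho>'\<close> by (intro thermostat_stay_low[OF th, of \<rho>' \<rho>]) auto
  qed
  ultimately show ?thesis using vr r_in by (intro disjI2 bexI[of _ r]) auto
qed

lemma thermostat_one_switch:
  assumes th: "thermostat \<epsilon> v i0 i" and st: "0 \<le> s" "s \<le> t"
    and osc: "\<And>r r'. \<lbrakk>r \<in> {s..t}; r' \<in> {s..t}\<rbrakk> \<Longrightarrow> \<bar>v r - v r'\<bar> \<le> \<epsilon>"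
  shows "(\<forall>r\<in>{s..t}. i r = i s) \<or>
    (\<exists>r\<in>{s..t}. v r = - of_int (i s) * \<epsilon> \<and> (\<forall>\<rho>\<in>{s..r}. i \<rho> = i s) \<and> (\<forall>\<rho>\<in>{r<..t}. i \<rho> = - i s))"
proof -
  have "i s = 1 \<or> i s = -1" using thermostat_range[OF th st(1)] .
  then show ?thesis
  proof
    assume "i s = 1"
    then show ?thesis using thermostat_one_switch_aux[OF th st osc] by simp
  next
    assume i: "i s = -1"
    have "\<bar>- v r - - v r'\<bar> \<le> \<epsilon>" if "r \<in> {s..t}" "r' \<in> {s..t}" for r r'
      using osc[OF that] by (simp add: abs_minus_commute)
    from thermostat_one_switch_aux[OF thermostat_uminus[OF th] st this] i
    have "(\<forall>r\<in>{s..t}. - i r = 1) \<or>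
      (\<exists>r\<in>{s..t}. - v r = - \<epsilon> \<and> (\<forall>\<rho>\<in>{s..r}. - i \<rho> = 1) \<and> (\<forall>\<rho>\<in>{r<..t}. - i \<rho> = - 1))"
      by simp
    moreover have "(- k = 1) = (k = -1)" "(- k = -1) = (k = 1)" for k :: int by auto
    ultimately show ?thesis by (simp add: i)
  qed
qed

lemma thermostat_mode_measurable:
  assumes th: "thermostat \<epsilon> v i0 i" and h: "0 < h"
    and osc: "\<And>r r'. \<lbrakk>0 \<le> r; r \<le> r'; r' \<le> r + h\<rbrakk> \<Longrightarrow> \<bar>v r - v r'\<bar> \<le> \<epsilon>"
  shows "{t \<in> {0..}. i t = 1} \<in> sets lebesgue"
proof -
  have piece: "{\<rho> \<in> {real k * h..real k * h + h}. i \<rho> = 1} \<in> sets lebesgue" (is "{\<rho> \<in> {?s..?t}. _} \<in> _") for k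
  proof -
    have st: "0 \<le> ?s" "?s \<le> ?t" using h by auto
    have osc': "\<bar>v r - v r'\<bar> \<le> \<epsilon>" if "r \<in> {?s..?t}" "r' \<in> {?s..?t}" for r r'
    proof -
      have "0 \<le> r" "0 \<le> r'" using that st(1) unfolding atLeastAtMost_iff by linarith+
      then show ?thesis
        using osc[of r r'] osc[of r' r] that by (cases "r \<le> r'") (auto simp: abs_minus_commute)
    qed
    note sw = thermostat_one_switch[OF th st osc']
    have s: "i ?s = 1 \<or> i ?s = -1" using thermostat_range[OF th st(1)] .
    consider "\<forall>r\<in>{?s..?t}. i r = i ?s"
      | r where "r\<in>{?s..?t}" "\<forall>\<rho>\<in>{?s..r}. i \<rho> = i ?s" "\<forall>\<rho>\<in>{r<..?t}. i \<rho> = - i ?s"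
      using sw by blast
    then show ?thesis
    proof cases
      case 1
      have "{\<rho> \<in> {?s..?t}. i \<rho> = 1} = (if i ?s = 1 then {?s..?t} else {})" (is "?X = ?Y")
      proof (intro set_eqI)
        fix \<rho>
        show "\<rho> \<in> ?X \<longleftrightarrow> \<rho> \<in> ?Y" using bspec[OF 1, of \<rho>] by auto
      qed
      then show ?thesis by simp
    next
      case 2
      have "{\<rho> \<in> {?s..?t}. i \<rho> = 1} = (if i ?s = 1 then {?s..r} else {r<..?t})"
        (is "?X = ?Y")
      proof (intro set_eqI)
        fix \<rho>
        show "\<rho> \<in> ?X \<longleftrightarrow> \<rho> \<in> ?Y"
          using s 2(1) bspec[OF 2(2), of \<rho>] bspec[OF 2(3), of \<rho>] by (cases "\<rho> \<le> r") auto
      qed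
      then show ?thesis by simp
    qed
  qed
  have "{t \<in> {0..}. i t = 1} = (\<Union>k. {\<rho> \<in> {real k * h..real k * h + h}. i \<rho> = 1})" (is "?L = ?R")
  proof
    show "?L \<subseteq> ?R"
    proof
      fix t assume "t \<in> ?L"
      then have t: "0 \<le> t" "i t = 1" by auto
      define k where "k = nat \<lfloor>t / h\<rfloor>"
      have "real k = of_int \<lfloor>t / h\<rfloor>" using t h by (simp add: k_def)
      then have "real k \<le> t / h" "t / h \<le> real k + 1" by linarith+
      then have "real k * h \<le> t" "t \<le> real k * h + h" using h by (auto simp: field_simps)
      then show "t \<in> ?R" using t by auto
    qed
    show "?R \<subseteq> ?L"
      using h by auto (metis mult_nonneg_nonneg less_imp_le of_nat_0_le_iff order_trans)
  qed
  then show ?thesis using piece by auto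
qed

section \<open>Existence of trajectories for the scalar equation\<close>

text \<open>
  The integral operator, written for \<open>y t = exp (- k t) Y t\<close>, is a contraction of the space of bounded
  continuous functions: the exponential weight makes a local argument global. The upper limit of the
  integral is \<open>max t 0\<close>, so that the operator acts on functions on the whole real line.
\<close>

lemma scalar_ode_exists:
  fixes G :: "real \<Rightarrow> real"
  assumes L: "0 \<le> L" and Lip: "\<And>x y. \<bar>G x - G y\<bar> \<le> L * \<bar>x - y\<bar>" and bd: "\<And>x. \<bar>G x\<bar> \<le> M"
  shows "\<exists>Y :: real \<Rightarrow> real. continuous_on {0..} Y \<and>
    (\<forall>t\<ge>0. Y t = x0 + integral {0..t} (\<lambda>s. G (Y s)))"
proof -
  define k where "k = 2 * L + 1"
  have k: "0 < k" using L by (simp add: k_def)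
  have M: "0 \<le> M" using bd[of 0] by linarith
  have Gc: "continuous_on UNIV G"
    by (rule lipschitz_on_continuous_on[of L]) (auto simp: lipschitz_on_def dist_real_def Lip L)
  define E where "E y s = G (exp (k * s) * apply_bcontfun y s)" for y :: "real \<Rightarrow>\<^sub>C real" and s
  have Ec: "continuous_on T (E y)" for y T
    unfolding E_def
    by (rule continuous_on_compose2[OF Gc]) (auto intro!: continuous_intros)
  then have Ei: "E y integrable_on {0..t}" for y t
    by (intro integrable_continuous_interval)
  define P where "P y t = exp (- k * max t 0) * (x0 + integral {0..max t 0} (E y))" for y t
  have Jc: "continuous_on {0..} (\<lambda>t. integral {0..t} (E y))" for y
  proof (subst continuous_on_eq_continuous_within, rule ballI)
    fix t :: real assume t: "t \<in> {0..}"
    have "continuous_on {0..t+1} (\<lambda>t. integral {0..t} (E y))"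
      by (rule indefinite_integral_continuous_1[OF Ei])
    then have "continuous (at t within {0..t+1}) (\<lambda>t. integral {0..t} (E y))"
      using t by (simp add: continuous_on_eq_continuous_within)
    moreover have "at t within {0..t+1} = at t within {0..}"
      by (rule at_within_nhd[of _ "{..<t+1}"]) auto
    ultimately show "continuous (at t within {0..}) (\<lambda>t. integral {0..t} (E y))" by simp
  qed
  have Pc: "continuous_on UNIV (P y)" for y
    unfolding P_def
    by (intro continuous_intros continuous_on_compose2[OF Jc]) auto
  have Pb: "norm (P y t) \<le> \<bar>x0\<bar> + M / k" for y t
  proof -
    define \<tau> where "\<tau> = max t 0"
    have \<tau>: "0 \<le> \<tau>" by (simp add: \<tau>_def)
    have "norm (integral {0..\<tau>} (E y)) \<le> integral {0..\<tau>} (\<lambda>_. M)"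
      by (rule integral_norm_bound_integral[OF Ei]) (auto simp: E_def bd)
    then have "\<bar>integral {0..\<tau>} (E y)\<bar> \<le> M * \<tau>" using \<tau> by (simp add: mult.commute)
    then have "\<bar>x0 + integral {0..\<tau>} (E y)\<bar> \<le> \<bar>x0\<bar> + M * \<tau>" by linarith
    then have "norm (P y t) \<le> exp (- k * \<tau>) * (\<bar>x0\<bar> + M * \<tau>)"
      by (simp add: P_def \<tau>_def abs_mult)
    also have "\<dots> = exp (- k * \<tau>) * \<bar>x0\<bar> + M / k * (k * \<tau> * exp (- k * \<tau>))"
      using k by (simp add: field_simps)
    also have "exp (- k * \<tau>) * \<bar>x0\<bar> \<le> 1 * \<bar>x0\<bar>" using k \<tau> by (intro mult_right_mono) auto
    also have "M / k * (k * \<tau> * exp (- k * \<tau>)) \<le> M / k * 1"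
    proof (rule mult_left_mono)
      have "k * \<tau> \<le> exp (k * \<tau>)" using exp_ge_add_one_self[of "k * \<tau>"] by linarith
      then have "k * \<tau> * exp (- k * \<tau>) \<le> exp (k * \<tau>) * exp (- k * \<tau>)" by (intro mult_right_mono) auto
      then show "k * \<tau> * exp (- k * \<tau>) \<le> 1" by (simp flip: exp_add)
    qed (use M k in auto)
    finally show ?thesis by simp
  qed
  define Q where "Q y = Bcontfun (P y)" for y
  have Q: "apply_bcontfun (Q y) t = P y t" for y t
    unfolding Q_def using bcontfun_normI[OF Pc Pb] by (simp add: Bcontfun_inverse)
  have contr: "dist (Q y) (Q z) \<le> 1/2 * dist y z" for y z
  proof (rule dist_bound)
    fix t :: real
    define D where "D = dist y z"
    define \<tau> where "\<tau> = max t 0"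
    have \<tau>: "0 \<le> \<tau>" by (simp add: \<tau>_def)
    have pt: "norm (E y s - E z s) \<le> L * D * exp (k * s)" for s
    proof -
      have "\<bar>E y s - E z s\<bar> \<le> L * \<bar>exp (k * s) * apply_bcontfun y s - exp (k * s) * apply_bcontfun z s\<bar>"
        unfolding E_def by (rule Lip)
      also have "\<dots> = L * (exp (k * s) * dist (apply_bcontfun y s) (apply_bcontfun z s))"
        by (simp add: dist_real_def abs_mult flip: right_diff_distrib)
      also have "\<dots> \<le> L * (exp (k * s) * D)"
        unfolding D_def using L by (intro mult_left_mono dist_bounded) auto
      finally show ?thesis by (simp add: mult_ac)
    qed
    have HI: "((\<lambda>s. L * D * exp (k * s)) has_integral L * D / k * exp (k * \<tau>) - L * D / k * exp (k * 0)) {0..\<tau>}"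
      using k \<tau>
      by (intro fundamental_theorem_of_calculus)
         (auto intro!: derivative_eq_intros simp flip: has_real_derivative_iff_has_vector_derivative)
    have "norm (integral {0..\<tau>} (\<lambda>s. E y s - E z s)) \<le> integral {0..\<tau>} (\<lambda>s. L * D * exp (k * s))"
      by (rule integral_norm_bound_integral[OF integrable_diff[OF Ei Ei] has_integral_integrable[OF HI]]) (rule pt)
    also have "\<dots> = L * D / k * exp (k * \<tau>) - L * D / k * exp (k * 0)"
      by (rule integral_unique[OF HI])
    also have "\<dots> \<le> L * D / k * exp (k * \<tau>)" using L k by (simp add: D_def)
    finally have *: "\<bar>integral {0..\<tau>} (E y) - integral {0..\<tau>} (E z)\<bar> \<le> L * D / k * exp (k * \<tau>)"
      by (simp add: integral_diff[OF Ei Ei])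
    have "dist (Q y t) (Q z t) = exp (- k * \<tau>) * \<bar>integral {0..\<tau>} (E y) - integral {0..\<tau>} (E z)\<bar>"
      by (simp add: Q P_def \<tau>_def dist_real_def abs_mult flip: right_diff_distrib)
    also have "\<dots> \<le> exp (- k * \<tau>) * (L * D / k * exp (k * \<tau>))" using * by (rule mult_left_mono) simp
    also have "\<dots> = L / k * D" by (simp add: exp_minus field_simps)
    also have "\<dots> \<le> 1/2 * D"
      using L by (intro mult_right_mono) (auto simp: k_def D_def field_simps)
    finally show "dist (Q y t) (Q z t) \<le> 1/2 * dist y z" by (simp add: D_def)
  qed
  obtain y where y: "Q y = y"
    using banach_fix_type[of "1/2" Q] contr by auto
  define Y where "Y t = exp (k * t) * apply_bcontfun y t" for t
  show ?thesis
  proof (intro exI conjI allI impI)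
    show "continuous_on {0..} Y" unfolding Y_def by (auto intro!: continuous_intros)
    fix t :: real assume t: "0 \<le> t"
    have "apply_bcontfun y t = exp (- k * t) * (x0 + integral {0..t} (E y))"
      using Q[of y t] t by (simp add: y P_def)
    then show "Y t = x0 + integral {0..t} (\<lambda>s. G (Y s))"
      by (simp add: Y_def E_def[abs_def] exp_minus)
  qed
qed

section \<open>The junction in branch coordinates\<close>

text \<open>A subsolution at the junction, with constants for the bounds that the data satisfy.\<close>

locale junction_subsolution_problem = junction_control A lam f l
  for A :: "'a::topological_space set" and lam :: real and f l :: "int \<Rightarrow> real \<Rightarrow> 'a \<Rightarrow> real" +
  fixes u :: "real \<Rightarrow> real" and L M :: real and \<omega> :: "real \<Rightarrow> real"
  assumes junction_sub: "junction_subsolution A lam f l u" and u_bounded: "bounded (range u)"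
    and L_nonneg: "0 \<le> L"
    and f_Lip: "\<lbrakk>j \<in> {1, -1}; x \<in> branch j; y \<in> branch j; a \<in> A\<rbrakk> \<Longrightarrow> \<bar>f j x a - f j y a\<bar> \<le> L * \<bar>x - y\<bar>"
    and f_bd: "\<lbrakk>j \<in> {1, -1}; x \<in> branch j; a \<in> A\<rbrakk> \<Longrightarrow> \<bar>f j x a\<bar> \<le> M"
    and l_bd: "\<lbrakk>j \<in> {1, -1}; x \<in> branch j; a \<in> A\<rbrakk> \<Longrightarrow> l j x a \<le> M"
    and \<omega>_cont: "continuous_on {0..} \<omega>" and \<omega>_mono: "mono_on {0..} \<omega>" and \<omega>_0: "\<omega> 0 = 0"
    and l_mod: "\<lbrakk>j \<in> {1, -1}; x \<in> branch j; y \<in> branch j; a \<in> A\<rbrakk> \<Longrightarrow> \<bar>l j x a - l j y a\<bar> \<le> \<omega> \<bar>x - y\<bar>"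
begin

text \<open>Dynamics, running cost and subsolution of branch \<open>j\<close> in the coordinate \<open>X = j x\<close>.\<close>

definition dyn :: "int \<Rightarrow> real \<Rightarrow> 'a \<Rightarrow> real" where "dyn j x a = of_int j * f j (of_int j * x) a"
definition rate :: "int \<Rightarrow> real \<Rightarrow> 'a \<Rightarrow> real" where "rate j x a = l j (of_int j * x) a"
definition profile :: "int \<Rightarrow> real \<Rightarrow> real" where "profile j x = u (of_int j * x)"

lemma hamiltonian_upper:
  assumes "j \<in> {1, -1}" "x \<in> branch j" "a \<in> A"
  shows "- f j x a * p - l j x a \<le> hamiltonian A f l j x p"
  unfolding hamiltonian_def
proof (rule cSUP_upper[OF assms(3)])
  have "- f j x b * p - l j x b \<le> M * \<bar>p\<bar>" if "b \<in> A" for b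
  proof -
    have "- f j x b * p \<le> \<bar>f j x b\<bar> * \<bar>p\<bar>" by (simp flip: abs_mult)
    also have "\<dots> \<le> M * \<bar>p\<bar>" using f_bd[OF assms(1,2) that] by (rule mult_right_mono) simp
    finally show ?thesis using l_nonneg[OF assms(1,2) that] by linarith
  qed
  then show "bdd_above ((\<lambda>a. - f j x a * p - l j x a) ` A)" unfolding bdd_above_def by blast
qed

lemma half_line:
  assumes j: "j \<in> {1, -1}"
  shows "half_line_subsolution A lam L M \<omega> (dyn j) (rate j) (profile j)"
proof
  have jj: "of_int j * of_int j = (1 :: real)" "\<bar>of_int j\<bar> = (1 :: real)" using j by auto
  have br: "of_int j * x \<in> branch j" if "0 \<le> x" for x :: real using j that by (auto simp: branch_def)
  have dist: "\<bar>of_int j * x - of_int j * y\<bar> = \<bar>x - y\<bar>" for x y :: real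
    by (simp add: jj abs_mult flip: right_diff_distrib)
  show "0 < lam" by (rule lam_pos)
  show "0 \<le> L" by (rule L_nonneg)
  show "continuous_on {0..} \<omega>" "mono_on {0..} \<omega>" "\<omega> 0 = 0" by (fact \<omega>_cont \<omega>_mono \<omega>_0)+
  show "\<bar>dyn j x a - dyn j y a\<bar> \<le> L * \<bar>x - y\<bar>" if "0 \<le> x" "0 \<le> y" "a \<in> A" for x y a
    using f_Lip[OF j br[OF that(1)] br[OF that(2)] that(3)]
    by (simp add: dyn_def dist jj abs_mult flip: right_diff_distrib)
  show "\<bar>dyn j x a\<bar> \<le> M" if "0 \<le> x" "a \<in> A" for x a
    using f_bd[OF j br[OF that(1)] that(2)] by (simp add: dyn_def abs_mult jj)
  show "0 \<le> rate j x a" if "0 \<le> x" "a \<in> A" for x a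
    using l_nonneg[OF j br[OF that(1)] that(2)] by (simp add: rate_def)
  show "\<bar>rate j x a - rate j y a\<bar> \<le> \<omega> \<bar>x - y\<bar>" if "0 \<le> x" "0 \<le> y" "a \<in> A" for x y a
    using l_mod[OF j br[OF that(1)] br[OF that(2)] that(3)] by (simp add: rate_def dist)
  show "\<exists>a\<in>A. dyn j 0 a < 0" "\<exists>a\<in>A. 0 < dyn j 0 a"
    using controllable[OF j] j by (auto simp: dyn_def)
  have uc: "continuous_on UNIV u" using junction_sub by (simp add: junction_subsolution_def)
  show "continuous_on UNIV (profile j)"
    unfolding profile_def by (rule continuous_on_compose2[OF uc]) (auto intro!: continuous_intros)
  fix \<phi> \<phi>' :: "real \<Rightarrow> real" and x a
  assume C1: "C1_on UNIV \<phi> \<phi>'" and x: "0 < x" and max: "local_max_at (\<lambda>y. profile j y - \<phi> y) x" and a: "a \<in> A"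
  have C1': "C1_on UNIV (\<lambda>y. \<phi> (of_int j * y)) (\<lambda>y. of_int j * \<phi>' (of_int j * y))"
    by (rule C1_on_scale[OF C1])
  have max': "local_max_at (\<lambda>y. u y - \<phi> (of_int j * y)) (of_int j * x)"
    by (rule local_max_at_scale[OF jj(1)]) (use max in \<open>simp add: profile_def\<close>)
  have C1'': "C1_on S (\<lambda>y. \<phi> (of_int j * y)) (\<lambda>y. of_int j * \<phi>' (of_int j * y))" for S
    using C1' by (auto simp: C1_on_def intro: continuous_on_subset)
  have "lam * u (of_int j * x) + hamiltonian A f l j (of_int j * x) (of_int j * \<phi>' (of_int j * (of_int j * x))) \<le> 0"
    using j
  proof (elim insertE emptyE)
    assume j1: "j = 1"
    have "viscosity_subsolution_on {0<..} (\<lambda>x r p. lam * r + hamiltonian A f l j x p) u"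
      using junction_sub by (simp add: junction_subsolution_def j1)
    from this[unfolded viscosity_subsolution_on_def, rule_format, OF C1'' _ max'] x
    show ?thesis by (simp add: j1)
  next
    assume j1: "j = -1"
    have "viscosity_subsolution_on {..<0} (\<lambda>x r p. lam * r + hamiltonian A f l j x p) u"
      using junction_sub by (simp add: junction_subsolution_def j1)
    from this[unfolded viscosity_subsolution_on_def, rule_format, OF C1'' _ max'] x
    show ?thesis by (simp add: j1)
  qed
  moreover have "of_int j * (of_int j * x) = x" by (simp add: jj flip: mult.assoc)
  ultimately have "lam * u (of_int j * x) + (- f j (of_int j * x) a * (of_int j * \<phi>' x) - l j (of_int j * x) a) \<le> 0"
    using hamiltonian_upper[OF j br[OF less_imp_le[OF x]] a, of "of_int j * \<phi>' x"] by simp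
  then show "lam * profile j x - dyn j x a * \<phi>' x - rate j x a \<le> 0"
    by (simp add: profile_def dyn_def rate_def algebra_simps)
qed

text \<open>
  The largest admissible slope in the branch coordinate. In the coordinate \<open>x\<close>, branch \<open>-1\<close> gets the
  slope \<open>- slope (-1)\<close>, its smallest admissible one.
\<close>

definition slope :: "int \<Rightarrow> real" where
  "slope j = Sup (half_line_subsolution.slopes A lam (dyn j) (rate j) (profile j))"

lemma slope_in: "j \<in> {1, -1} \<Longrightarrow> slope j \<in> half_line_subsolution.slopes A lam (dyn j) (rate j) (profile j)"
  unfolding slope_def by (rule half_line_subsolution.Sup_slopes[OF half_line])

text \<open>
  The only use of the condition at the junction: the two slopes are ordered as needed for
  \<open>test_value_switch\<close>.
\<close>

lemma slopes_compatible: "0 \<le> slope 1 + slope (-1)"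
proof (rule ccontr)
  assume "\<not> ?thesis"
  then obtain p where p: "slope 1 < p" "p < - slope (-1)" using dense[of "slope 1" "- slope (-1)"] by auto
  have h1: "(1::int) \<in> {1, -1}" and h2: "(-1::int) \<in> {1, -1}" by auto
  interpret r: half_line_subsolution A lam L M \<omega> "dyn 1" "rate 1" "profile 1" by (rule half_line[OF h1])
  interpret s: half_line_subsolution A lam L M \<omega> "dyn (-1)" "rate (-1)" "profile (-1)" by (rule half_line[OF h2])
  obtain d1 where d1: "0 < d1" "\<And>z. \<lbrakk>0 \<le> z; z < d1\<rbrakk> \<Longrightarrow> profile 1 z \<le> profile 1 0 + p * z"
    using r.below_steep_line p(1) unfolding slope_def by blast
  have "slope (-1) < - p" using p(2) by simp
  then obtain d2 where d2: "0 < d2" "\<And>z. \<lbrakk>0 \<le> z; z < d2\<rbrakk> \<Longrightarrow> profile (-1) z \<le> profile (-1) 0 + (- p) * z"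
    using s.below_steep_line unfolding slope_def by blast
  have "u y - p * y \<le> u 0 - p * 0" if "y \<in> {- d2<..<d1}" for y
    using d1(2)[of y] d2(2)[of "- y"] that by (cases "0 \<le> y") (auto simp: profile_def)
  moreover have "\<forall>\<^sub>F y in nhds 0. y \<in> {- d2<..<d1}"
    using d1(1) d2(1) by (intro eventually_nhds_in_open) auto
  ultimately have "local_max_at (\<lambda>y. u y - p * y) 0"
    unfolding local_max_at_def by (auto elim: eventually_mono)
  moreover have "C1_on UNIV (\<lambda>y. p * y) (\<lambda>_. p)"
    unfolding C1_on_def by (auto intro!: derivative_eq_intros)
  ultimately have "min (lam * u 0 + hamiltonian A f l 1 0 p) (lam * u 0 + hamiltonian A f l (-1) 0 p) \<le> 0"
    using junction_sub unfolding junction_subsolution_def by blast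
  then obtain j :: int where j: "j \<in> {1, -1}" "lam * u 0 + hamiltonian A f l j 0 p \<le> 0"
    by (auto simp: min_le_iff_disj)
  have "lam * u 0 - f j 0 a * p - l j 0 a \<le> 0" if "a \<in> A" for a
    using hamiltonian_upper[OF j(1) _ that, of 0 p] j by (auto simp: branch_def)
  then have "of_int j * p \<in> half_line_subsolution.slopes A lam (dyn j) (rate j) (profile j)"
    unfolding half_line_subsolution.slopes_def[OF half_line[OF j(1)]]
    using j(1) by (auto simp: dyn_def rate_def profile_def)
  then have "of_int j * p \<le> slope j"
    unfolding slope_def by (rule cSup_upper[OF _ half_line_subsolution.slopes_bdd_above[OF half_line[OF j(1)]]])
  then show False using j(1) p by auto
qed

section \<open>Comparison with the thermostatic value functions\<close>

text \<open>The approximate subsolution \<open>W\<^sub>\<epsilon> j\<close> for mode \<open>j\<close>. It satisfies the equation of that mode, up to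
  an error, only for \<open>j x > - 2 \<epsilon>\<close>.\<close>

definition test_value :: "real \<Rightarrow> int \<Rightarrow> real \<Rightarrow> real" where
  "test_value \<epsilon> j x = half_line_subsolution.glued (profile j) (slope j) \<epsilon> (of_int j * x)"

text \<open>A bound for the violation of the equation by \<open>test_value \<epsilon>\<close>, common to both modes.\<close>

definition error :: "real \<Rightarrow> real" where
  "error \<epsilon> = (\<Sum>j\<in>{1, -1}. half_line_subsolution.defect lam L \<omega> (profile j) (slope j) \<epsilon>)"

lemma defect_le_error:
  assumes "j \<in> {1, -1}" "0 \<le> \<epsilon>"
  shows "half_line_subsolution.defect lam L \<omega> (profile j) (slope j) \<epsilon> \<le> error \<epsilon>"
  unfolding error_def
  using assms by (intro member_le_sum half_line_subsolution.defect_nonneg[OF half_line]) auto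

lemma error_nonneg: "0 \<le> \<epsilon> \<Longrightarrow> 0 \<le> error \<epsilon>"
  unfolding error_def by (intro sum_nonneg half_line_subsolution.defect_nonneg[OF half_line])

lemma test_value_switch:
  assumes "j \<in> {1, -1}" "0 < \<epsilon>" "x = - of_int j * \<epsilon>"
  shows "test_value \<epsilon> j x \<le> test_value \<epsilon> (- j) x"
proof -
  have mj: "- j \<in> {1, -1}" using assms(1) by auto
  have jx: "of_int j * x = - \<epsilon>" "of_int (- j) * x = \<epsilon>" using assms by auto
  have "0 \<le> (slope j + slope (- j)) * \<epsilon>"
    using slopes_compatible assms(1,2) by (intro mult_nonneg_nonneg) auto
  then show ?thesis
    unfolding test_value_def jx half_line_subsolution.glued_def[OF half_line[OF assms(1)]]
      half_line_subsolution.glued_def[OF half_line[OF mj]]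
    using assms(2) by (simp add: profile_def algebra_simps)
qed

lemma test_value_bounded:
  assumes \<epsilon>: "0 < \<epsilon>"
  obtains B where "\<And>j x. \<lbrakk>j \<in> {1, -1}; - \<epsilon> \<le> of_int j * x\<rbrakk> \<Longrightarrow> \<bar>test_value \<epsilon> j x\<bar> \<le> B"
proof -
  obtain B where B: "\<And>x. \<bar>u x\<bar> \<le> B" using u_bounded by (auto simp: bounded_iff)
  have "\<bar>test_value \<epsilon> j x\<bar> \<le> 3 * B + (\<bar>slope 1\<bar> + \<bar>slope (-1)\<bar>) * \<epsilon>"
    if j: "j \<in> {1, -1}" and x: "- \<epsilon> \<le> of_int j * x" for j x
  proof -
    have s: "\<bar>slope j\<bar> \<le> \<bar>slope 1\<bar> + \<bar>slope (-1)\<bar>" using j by auto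
    have *: "\<bar>slope j * z\<bar> \<le> (\<bar>slope 1\<bar> + \<bar>slope (-1)\<bar>) * \<epsilon>" if "\<bar>z\<bar> \<le> \<epsilon>" for z
      unfolding abs_mult using s that by (intro mult_mono) auto
    have P: "\<bar>profile j z\<bar> \<le> B" for z by (simp add: profile_def B)
    show ?thesis
    proof (cases "of_int j * x \<le> \<epsilon>")
      case True
      then have "test_value \<epsilon> j x = profile j 0 + slope j * (of_int j * x)"
        by (simp add: test_value_def half_line_subsolution.glued_def[OF half_line[OF j]])
      moreover have "\<bar>slope j * (of_int j * x)\<bar> \<le> (\<bar>slope 1\<bar> + \<bar>slope (-1)\<bar>) * \<epsilon>"
        using True x by (intro *) auto
      ultimately show ?thesis using P[of 0] by linarith
    next
      case False
      then have "test_value \<epsilon> j x = profile j (of_int j * x) + (profile j 0 + slope j * \<epsilon> - profile j \<epsilon>)"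
        by (simp add: test_value_def half_line_subsolution.glued_def[OF half_line[OF j]])
      moreover have "\<bar>slope j * \<epsilon>\<bar> \<le> (\<bar>slope 1\<bar> + \<bar>slope (-1)\<bar>) * \<epsilon>"
        using \<epsilon> by (intro *) auto
      ultimately show ?thesis using P[of 0] P[of \<epsilon>] P[of "of_int j * x"] by linarith
    qed
  qed
  then show ?thesis using that by blast
qed

lemma extend_dyn:
  "j \<in> {1, -1} \<Longrightarrow> extend_const f j x a = of_int j * dyn j (max (of_int j * x) 0) a"
  by (auto simp: extend_const_def dyn_def min_def max_def)

lemma extend_rate:
  "j \<in> {1, -1} \<Longrightarrow> extend_const l j x a = rate j (max (of_int j * x) 0) a"
  by (auto simp: extend_const_def rate_def min_def max_def)

lemma extend_f_bound: "\<lbrakk>j \<in> {1, -1}; a \<in> A\<rbrakk> \<Longrightarrow> \<bar>extend_const f j x a\<bar> \<le> M"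
  unfolding extend_const_def by (rule f_bd) (auto simp: branch_def)

lemma extend_l_bound: "\<lbrakk>j \<in> {1, -1}; a \<in> A\<rbrakk> \<Longrightarrow> 0 \<le> extend_const l j x a \<and> extend_const l j x a \<le> M"
  unfolding extend_const_def by (intro conjI l_nonneg l_bd) (auto simp: branch_def)

lemma extend_l_measurable:
  assumes j: "j \<in> {1, -1}" and \<alpha>: "\<alpha> \<in> controls A" and x: "continuous_on {0..} x"
  shows "(\<lambda>t. extend_const l j (x t) (\<alpha> t)) \<in> borel_measurable (lebesgue_on {0..})"
proof (rule caratheodory_measurable[OF \<alpha> x _ _ \<omega>_cont \<omega>_0])
  define pr where "pr y = (if j = 1 then max y 0 else min y 0)" for y :: real
  have pr: "pr y \<in> branch j" for y by (simp add: pr_def branch_def)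
  show "continuous_on A (extend_const l j y)" for y
  proof -
    have "continuous_on A (\<lambda>a. (\<lambda>(x, a). l j x a) (pr y, a))"
      by (rule continuous_on_compose2[OF l_continuous[OF j]]) (auto intro!: continuous_intros pr)
    then show ?thesis by (simp add: extend_const_def[abs_def] pr_def)
  qed
  fix y z a assume a: "a \<in> A"
  have "\<bar>l j (pr y) a - l j (pr z) a\<bar> \<le> \<omega> \<bar>pr y - pr z\<bar>" by (rule l_mod[OF j pr pr a])
  also have "\<dots> \<le> \<omega> \<bar>y - z\<bar>"
    by (rule mono_onD[OF \<omega>_mono]) (auto simp: pr_def)
  finally show "\<bar>extend_const l j y a - extend_const l j z a\<bar> \<le> \<omega> \<bar>y - z\<bar>"
    by (simp add: extend_const_def pr_def)
qed

lemma discount_integral: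
  "set_integrable lebesgue {0..} (\<lambda>t. exp (- lam * t))" "(LINT t:{0..}|lebesgue. exp (- lam * t)) = 1 / lam"
proof -
  have I: "((\<lambda>t. exp (- lam * t)) has_integral 1 / lam) {0..}"
    using has_integral_exp_minus_to_infinity[OF lam_pos, of 0] by simp
  then show int: "set_integrable lebesgue {0..} (\<lambda>t. exp (- lam * t))"
    by (intro nonnegative_absolutely_integrable_1) (auto dest: has_integral_integrable)
  show "(LINT t:{0..}|lebesgue. exp (- lam * t)) = 1 / lam"
    using set_lebesgue_integral_eq_integral(2)[OF int] integral_unique[OF I] by simp
qed

text \<open>
  Time is advanced in steps of length \<open>h\<close> so short that at most one switch occurs in each; in
  between, \<open>suboptimality\<close> applies, and at a switch \<open>test_value_switch\<close>.
\<close>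

lemma test_value_le_cost:
  assumes \<epsilon>: "0 < \<epsilon>" and \<alpha>: "\<alpha> \<in> controls A" and tr: "trajectory f \<epsilon> x0 j0 \<alpha> x i"
  shows "test_value \<epsilon> j0 x0 \<le> cost l lam \<alpha> x i + error \<epsilon> / lam"
proof -
  have th: "thermostat \<epsilon> x j0 i" using tr by (simp add: trajectory_def)
  have xc: "continuous_on {0..} x" by (rule thermostat_continuous[OF th])
  have \<alpha>A: "\<alpha> t \<in> A" if "0 \<le> t" for t using \<alpha> that by (simp add: controls_def)
  have imode: "i t \<in> {1, -1}" if "0 \<le> t" for t using thermostat_range[OF th that] by auto
  define F where "F s = extend_const f (i s) (x s) (\<alpha> s)" for s
  define C where "C s = extend_const l (i s) (x s) (\<alpha> s)" for s
  define \<kappa> where "\<kappa> = error \<epsilon>"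
  have \<kappa>: "0 \<le> \<kappa>" using error_nonneg \<epsilon> by (simp add: \<kappa>_def)
  have Fi0: "set_integrable lebesgue {0..t} F" and xt: "x t = x0 + (LINT s:{0..t}|lebesgue. F s)" if "0 \<le> t" for t
    using tr that by (auto simp: trajectory_def F_def[abs_def])
  have Fi: "set_integrable lebesgue {s<..t} F" if "0 \<le> s" "s \<le> t" for s t
    using Fi0[of t] that by (auto intro: set_integrable_subset)
  have incr: "x t - x s = (LINT \<rho>:{s<..t}|lebesgue. F \<rho>)" if st: "0 \<le> s" "s \<le> t" for s t
  proof -
    have "{0..t} = {0..s} \<union> {s<..t}" using st by auto
    moreover have "(LINT \<rho>:{0..s} \<union> {s<..t}|lebesgue. F \<rho>)
        = (LINT \<rho>:{0..s}|lebesgue. F \<rho>) + (LINT \<rho>:{s<..t}|lebesgue. F \<rho>)"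
      by (rule set_integral_Un[OF _ Fi0[OF st(1)] Fi[OF st]]) auto
    ultimately show ?thesis using xt[of s] xt[of t] st by simp
  qed
  have F_bd: "\<bar>F s\<bar> \<le> M" if "0 \<le> s" for s
    unfolding F_def by (rule extend_f_bound[OF imode \<alpha>A]) (use that in auto)
  have M0: "0 \<le> M" using F_bd[of 0] by simp
  have x_Lip: "\<bar>x t - x s\<bar> \<le> M * (t - s)" if st: "0 \<le> s" "s \<le> t" for s t
  proof -
    have bd: "- M \<le> F \<rho>" "F \<rho> \<le> M" if "\<rho> \<in> {s<..t}" for \<rho> using F_bd[of \<rho>] that st by auto
    have "(- M) * (t - s) \<le> x t - x s" unfolding incr[OF st]
      by (rule set_integral_lower_bound[OF st(2) Fi[OF st]]) (rule bd)
    moreover have "(- M) * (t - s) \<le> (LINT \<rho>:{s<..t}|lebesgue. - F \<rho>)"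
      by (rule set_integral_lower_bound[OF st(2)]) (use bd Fi[OF st] in \<open>auto simp: set_integrable_def\<close>)
    ultimately show ?thesis using incr[OF st] by (simp add: set_lebesgue_integral_def abs_le_iff)
  qed
  define h where "h = \<epsilon> / (M + 1)"
  have h: "0 < h" using \<epsilon> M0 by (simp add: h_def)
  have osc: "\<bar>x r - x r'\<bar> \<le> \<epsilon>" if r: "0 \<le> r" "r \<le> r'" "r' \<le> r + h" for r r'
  proof -
    have "\<bar>x r' - x r\<bar> \<le> M * (r' - r)" using r by (intro x_Lip) auto
    also have "\<dots> \<le> (M + 1) * h" using r M0 by (intro mult_mono) auto
    also have "\<dots> = \<epsilon>" using M0 by (simp add: h_def)
    finally show ?thesis by (simp add: abs_minus_commute)
  qed
  \<comment> \<open>Measurability of the integrand matters: the cost of a nonintegrable one would be \<open>0\<close>.\<close>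
  have C_meas: "C \<in> borel_measurable (lebesgue_on {0..})"
  proof -
    have "{t \<in> {0..}. i t = 1} \<in> sets lebesgue" by (rule thermostat_mode_measurable[OF th h osc])
    then have "{t \<in> space (lebesgue_on {0..}). i t = 1} \<in> sets (lebesgue_on {0..})"
      by (auto simp: sets_restrict_space_iff space_restrict_space)
    then have "(\<lambda>t. if i t = 1 then extend_const l 1 (x t) (\<alpha> t) else extend_const l (-1) (x t) (\<alpha> t))
        \<in> borel_measurable (lebesgue_on {0..})"
      by (intro measurable_If extend_l_measurable \<alpha> xc) auto
    moreover have "(if i t = 1 then extend_const l 1 (x t) (\<alpha> t) else extend_const l (-1) (x t) (\<alpha> t)) = C t"
      if "t \<in> space (lebesgue_on {0..})" for t
      using imode[of t] that by (auto simp: C_def space_restrict_space)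
    ultimately show ?thesis by (subst (asm) measurable_cong) auto
  qed
  have C_bd: "0 \<le> C t" "C t \<le> M" if "0 \<le> t" for t
    using extend_l_bound[OF imode \<alpha>A] that by (auto simp: C_def)
  have meas: "set_borel_measurable lebesgue {0..} (\<lambda>t. k t * C t)" if "continuous_on {0..} k" for k :: "real \<Rightarrow> real"
  proof -
    have "(\<lambda>t. k t * C t) \<in> borel_measurable (lebesgue_on {0..})"
      using C_meas continuous_imp_measurable_on_sets_lebesgue[OF that] by (intro borel_measurable_times) auto
    then show ?thesis by (subst (asm) borel_measurable_restrict_space_iff) (auto simp: set_borel_measurable_def)
  qed
  have eC: "set_integrable lebesgue {0..} (\<lambda>t. exp (- lam * t) * C t)"
  proof (rule set_integrable_bound)
    show "set_integrable lebesgue {0..} (\<lambda>t. M * exp (- lam * t))" using discount_integral(1) by simp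
    show "set_borel_measurable lebesgue {0..} (\<lambda>t. exp (- lam * t) * C t)"
      by (rule meas) (intro continuous_intros)
    have "norm (exp (- lam * t) * C t) \<le> norm (M * exp (- lam * t))" if "0 \<le> t" for t
      using C_bd[OF that] M0 by (simp add: abs_mult mult.commute mult_left_mono)
    then show "AE t in lebesgue. t \<in> {0..} \<longrightarrow> norm (exp (- lam * t) * C t) \<le> norm (M * exp (- lam * t))"
      by auto
  qed
  have eC\<kappa>: "set_integrable lebesgue {0..} (\<lambda>t. exp (- lam * t) * (C t + \<kappa>))"
    using set_integral_add(1)[OF eC set_integrable_mult_left[OF discount_integral(1), of \<kappa>]]
    by (simp add: distrib_left)
  have total: "(LINT t:{0..}|lebesgue. exp (- lam * t) * (C t + \<kappa>)) = cost l lam \<alpha> x i + \<kappa> / lam"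
  proof -
    have "(LINT t:{0..}|lebesgue. exp (- lam * t) * (C t + \<kappa>))
        = (LINT t:{0..}|lebesgue. exp (- lam * t) * C t) + (LINT t:{0..}|lebesgue. exp (- lam * t) * \<kappa>)"
      using set_integral_add(2)[OF eC set_integrable_mult_left[OF discount_integral(1), of \<kappa>]]
      by (simp add: distrib_left)
    then show ?thesis using discount_integral(2) by (simp add: cost_def C_def)
  qed
  have eC\<kappa>_sub: "set_integrable lebesgue {s<..t} (\<lambda>t. exp (- lam * t) * (C t + \<kappa>))" if "0 \<le> s" for s t
    using that by (intro set_integrable_subset[OF eC\<kappa>]) auto
  have C\<kappa>_sub: "set_integrable lebesgue {s<..t} (\<lambda>t. C t + \<kappa>)" if st: "0 \<le> s" "s \<le> t" for s t
  proof (rule set_integrable_bound[OF set_integrable_mult_right[OF eC\<kappa>_sub[OF st(1)]]])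
    have "set_borel_measurable lebesgue {0..} C" using meas[of "\<lambda>_. 1"] by simp
    then have "set_borel_measurable lebesgue {s<..t} C"
      by (rule set_borel_measurable_subset) (use st in auto)
    moreover have "set_borel_measurable lebesgue {s<..t} (\<lambda>_. \<kappa>)"
      unfolding set_borel_measurable_def by (intro borel_measurable_scaleR borel_measurable_indicator) auto
    ultimately show "set_borel_measurable lebesgue {s<..t} (\<lambda>\<rho>. C \<rho> + \<kappa>)"
      unfolding set_borel_measurable_def scaleR_add_right by (rule borel_measurable_add)
    have "norm (C \<rho> + \<kappa>) \<le> norm (exp (lam * t) * (exp (- lam * \<rho>) * (C \<rho> + \<kappa>)))" if "\<rho> \<in> {s<..t}" for \<rho>
    proof -
      have "0 \<le> C \<rho> + \<kappa>" using C_bd(1)[of \<rho>] \<kappa> that st by auto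
      moreover have "1 \<le> exp (lam * t) * exp (- lam * \<rho>)"
        using that lam_pos by (simp flip: exp_add right_diff_distrib)
      ultimately have "1 * (C \<rho> + \<kappa>) \<le> exp (lam * t) * exp (- lam * \<rho>) * (C \<rho> + \<kappa>)"
        by (intro mult_right_mono)
      then show ?thesis using \<open>0 \<le> C \<rho> + \<kappa>\<close> by (simp add: abs_mult)
    qed
    then show "AE \<rho> in lebesgue. \<rho> \<in> {s<..t} \<longrightarrow>
        norm (C \<rho> + \<kappa>) \<le> norm (exp (lam * t) * (exp (- lam * \<rho>) * (C \<rho> + \<kappa>)))" by auto
  qed
  have stays: "- \<epsilon> \<le> of_int (i t) * x t" if "0 \<le> t" for t
    using thermostat_range[OF th that] thermostat_low[OF th that] thermostat_high[OF th that] by force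
  have piece: "exp (- lam * s) * test_value \<epsilon> j (x s) \<le> exp (- lam * t) * test_value \<epsilon> j (x t)
      + (LINT \<rho>:{s<..t}|lebesgue. exp (- lam * \<rho>) * (C \<rho> + \<kappa>))"
    if j: "j \<in> {1, -1}" and st: "0 \<le> s" "s \<le> t" and mode: "\<And>\<rho>. \<rho> \<in> {s<..t} \<Longrightarrow> i \<rho> = j"
      and xs: "- \<epsilon> \<le> of_int j * x s" for j s t
  proof -
    interpret half_line_subsolution A lam L M \<omega> "dyn j" "rate j" "profile j" by (rule half_line[OF j])
    define X where "X \<rho> = of_int j * x \<rho>" for \<rho>
    have jj: "of_int j * (of_int j * z) = z" for z :: real using j by auto
    have Feq: "of_int j * F \<rho> = dyn j (max (X \<rho>) 0) (\<alpha> \<rho>)" if "\<rho> \<in> {s<..t}" for \<rho>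
      using mode[OF that] by (simp add: F_def extend_dyn[OF j] X_def jj)
    have Ceq: "C \<rho> = rate j (max (X \<rho>) 0) (\<alpha> \<rho>)" if "\<rho> \<in> {s<..t}" for \<rho>
      using mode[OF that] by (simp add: C_def extend_rate[OF j] X_def)
    have "exp (- lam * s) * glued (slope j) \<epsilon> (X s) \<le> exp (- lam * t) * glued (slope j) \<epsilon> (X t)
      + (LINT \<rho>:{s<..t}|lebesgue. exp (- lam * \<rho>) * (rate j (max (X \<rho>) 0) (\<alpha> \<rho>) + \<kappa>))"
    proof (rule suboptimality[where b = "- 2 * \<epsilon>" and \<eta> = \<epsilon>])
      show "continuous_on {- 2 * \<epsilon>..} (glued (slope j) \<epsilon>)"
        by (rule continuous_on_subset[OF glued_continuous]) auto
      show "lam * glued (slope j) \<epsilon> y - dyn j (max y 0) a * q - rate j (max y 0) a \<le> \<kappa>"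
        if "- 2 * \<epsilon> < y" "a \<in> A" "\<forall>\<^sub>F z in nhds y. glued (slope j) \<epsilon> z
            \<le> glued (slope j) \<epsilon> y + q * (z - y) + K * (z - y)\<^sup>2" for y q K a
        using glued_superjet[OF slope_in[OF j] \<epsilon> that] defect_le_error[OF j less_imp_le[OF \<epsilon>]]
        by (simp add: \<kappa>_def)
      show "\<alpha> \<rho> \<in> A" if "\<rho> \<in> {s<..t}" for \<rho> using that st by (intro \<alpha>A) auto
      show "continuous_on {s..t} X"
        unfolding X_def using st by (intro continuous_intros continuous_on_subset[OF xc]) auto
      show "X r' - X r = (LINT \<rho>:{r<..r'}|lebesgue. dyn j (max (X \<rho>) 0) (\<alpha> \<rho>))"
        if r: "s \<le> r" "r \<le> r'" "r' \<le> t" for r r'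
      proof -
        have "X r' - X r = of_int j * (x r' - x r)" by (simp add: X_def algebra_simps)
        also have "\<dots> = (LINT \<rho>:{r<..r'}|lebesgue. of_int j * F \<rho>)" using incr[of r r'] r st by simp
        also have "\<dots> = (LINT \<rho>:{r<..r'}|lebesgue. dyn j (max (X \<rho>) 0) (\<alpha> \<rho>))"
          using r by (intro set_lebesgue_integral_cong) (auto intro!: Feq)
        finally show ?thesis .
      qed
      have "set_integrable lebesgue {s<..t} (\<lambda>\<rho>. of_int j * F \<rho>)" using Fi[OF st] by simp
      then show "set_integrable lebesgue {s<..t} (\<lambda>\<rho>. dyn j (max (X \<rho>) 0) (\<alpha> \<rho>))"
        by (rule set_integrable_cong[THEN iffD1, rotated -1]) (auto intro!: Feq)
      show "set_integrable lebesgue {s<..t} (\<lambda>\<rho>. rate j (max (X \<rho>) 0) (\<alpha> \<rho>) + \<kappa>)"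
        using C\<kappa>_sub[OF st] by (rule set_integrable_cong[THEN iffD1, rotated -1]) (auto intro!: Ceq)
      show "set_integrable lebesgue {s<..t} (\<lambda>\<rho>. exp (- lam * \<rho>) * (rate j (max (X \<rho>) 0) (\<alpha> \<rho>) + \<kappa>))"
        using eC\<kappa>_sub[OF st(1)] by (rule set_integrable_cong[THEN iffD1, rotated -1]) (auto intro!: Ceq)
      show "- 2 * \<epsilon> + \<epsilon> \<le> X \<rho>" if "\<rho> \<in> {s..t}" for \<rho>
        using that xs mode[of \<rho>] stays[of \<rho>] st by (cases "\<rho> = s") (auto simp: X_def)
    qed (use \<kappa> st \<epsilon> in auto)
    also have "(LINT \<rho>:{s<..t}|lebesgue. exp (- lam * \<rho>) * (rate j (max (X \<rho>) 0) (\<alpha> \<rho>) + \<kappa>))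
       = (LINT \<rho>:{s<..t}|lebesgue. exp (- lam * \<rho>) * (C \<rho> + \<kappa>))"
      by (intro set_lebesgue_integral_cong) (auto simp: Ceq)
    finally show ?thesis by (simp add: test_value_def X_def)
  qed
  define E where "E t = exp (- lam * t) * test_value \<epsilon> (i t) (x t)
      + (LINT \<rho>:{0<..t}|lebesgue. exp (- lam * \<rho>) * (C \<rho> + \<kappa>))" for t
  have split: "(LINT \<rho>:{s<..t}|lebesgue. exp (- lam * \<rho>) * (C \<rho> + \<kappa>))
      = (LINT \<rho>:{s<..r}|lebesgue. exp (- lam * \<rho>) * (C \<rho> + \<kappa>))
        + (LINT \<rho>:{r<..t}|lebesgue. exp (- lam * \<rho>) * (C \<rho> + \<kappa>))" if "0 \<le> s" "s \<le> r" "r \<le> t" for s r t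
    using that by (intro set_integral_Ioc_add eC\<kappa>_sub)
  have E_mono: "E 0 \<le> E T" if T: "0 \<le> T" for T
  proof (rule mono_from_uniform_steps[OF h T])
    fix r r' assume r: "0 \<le> r" "r \<le> r'" "r' \<le> T" "r' \<le> r + h"
    define j where "j = i r"
    have j: "j \<in> {1, -1}" "- j \<in> {1, -1}" using imode[OF r(1)] by (auto simp: j_def)
    have jx: "- \<epsilon> \<le> of_int j * x r" using stays[OF r(1)] by (simp add: j_def)
    have osc': "\<bar>x \<rho> - x \<rho>'\<bar> \<le> \<epsilon>" if "\<rho> \<in> {r..r'}" "\<rho>' \<in> {r..r'}" for \<rho> \<rho>'
      using osc[of \<rho> \<rho>'] osc[of \<rho>' \<rho>] that r by (cases "\<rho> \<le> \<rho>'") (auto simp: abs_minus_commute)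
    have "exp (- lam * r) * test_value \<epsilon> j (x r) \<le> exp (- lam * r') * test_value \<epsilon> (i r') (x r')
      + (LINT \<rho>:{r<..r'}|lebesgue. exp (- lam * \<rho>) * (C \<rho> + \<kappa>))"
    proof (cases "\<forall>\<rho>\<in>{r..r'}. i \<rho> = j")
      case True
      then have "i \<rho> = j" if "\<rho> \<in> {r<..r'}" for \<rho> using that by auto
      moreover have "i r' = j" using True r by auto
      ultimately show ?thesis using piece[OF j(1) r(1,2) _ jx] by simp
    next
      case False
      then obtain q where q: "q \<in> {r..r'}" "x q = - of_int j * \<epsilon>"
        "\<forall>\<rho>\<in>{r..q}. i \<rho> = j" "\<forall>\<rho>\<in>{q<..r'}. i \<rho> = - j"
        using thermostat_one_switch[OF th r(1,2) osc'] unfolding j_def by blast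
      have "q < r'" using False q(1,3) by (cases "q = r'") auto
      then have "i r' = - j" using q(4) by auto
      have "exp (- lam * r) * test_value \<epsilon> j (x r) \<le> exp (- lam * q) * test_value \<epsilon> j (x q)
        + (LINT \<rho>:{r<..q}|lebesgue. exp (- lam * \<rho>) * (C \<rho> + \<kappa>))"
        using q r by (intro piece[OF j(1) _ _ _ jx]) auto
      also have "exp (- lam * q) * test_value \<epsilon> j (x q) \<le> exp (- lam * q) * test_value \<epsilon> (- j) (x q)"
        using test_value_switch[OF j(1) \<epsilon> q(2)] by (rule mult_left_mono) simp
      also have "\<dots> \<le> exp (- lam * r') * test_value \<epsilon> (- j) (x r')
        + (LINT \<rho>:{q<..r'}|lebesgue. exp (- lam * \<rho>) * (C \<rho> + \<kappa>))"
      proof (rule piece[OF j(2)])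
        show "- \<epsilon> \<le> of_int (- j) * x q" using q(2) j \<epsilon> by auto
      qed (use q r in auto)
      finally show ?thesis
        using split[of r q r'] q(1) r(1) \<open>i r' = - j\<close> by simp
    qed
    then show "E r \<le> E r'"
      using split[of 0 r r'] r by (simp add: E_def j_def)
  qed
  obtain B where B: "\<And>j x. \<lbrakk>j \<in> {1, -1}; - \<epsilon> \<le> of_int j * x\<rbrakk> \<Longrightarrow> \<bar>test_value \<epsilon> j x\<bar> \<le> B"
    using test_value_bounded[OF \<epsilon>] by blast
  have start: "E 0 = test_value \<epsilon> j0 x0"
  proof -
    have "x 0 = x0" using xt[of 0] set_lebesgue_integral_eq_integral(2)[OF Fi0[of 0]] by simp
    then show ?thesis using thermostat_initial[OF th] by (simp add: E_def set_lebesgue_integral_def)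
  qed
  have bound: "test_value \<epsilon> j0 x0 \<le> exp (- lam * T) * B + (cost l lam \<alpha> x i + \<kappa> / lam)" if T: "0 \<le> T" for T
  proof -
    have "(LINT \<rho>:{0<..T}|lebesgue. exp (- lam * \<rho>) * (C \<rho> + \<kappa>)) \<le> (LINT \<rho>:{0..}|lebesgue. exp (- lam * \<rho>) * (C \<rho> + \<kappa>))"
      unfolding set_lebesgue_integral_def
      by (rule integral_mono) (use eC\<kappa> eC\<kappa>_sub C_bd \<kappa> in \<open>auto simp: set_integrable_def indicator_def\<close>)
    moreover have "exp (- lam * T) * test_value \<epsilon> (i T) (x T) \<le> exp (- lam * T) * B"
      using B[OF imode[OF T] stays[OF T]] by (intro mult_left_mono) auto
    ultimately show ?thesis using E_mono[OF T] unfolding start total E_def[of T] by linarith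
  qed
  have "((\<lambda>T. exp (- lam * T) * B + (cost l lam \<alpha> x i + \<kappa> / lam)) \<longlongrightarrow> 0 * B + (cost l lam \<alpha> x i + \<kappa> / lam)) at_top"
  proof (intro tendsto_intros)
    have "filterlim (\<lambda>T. lam * T) at_top at_top"
      using lam_pos by (intro filterlim_tendsto_pos_mult_at_top[OF tendsto_const]) (auto simp: filterlim_ident)
    then show "((\<lambda>T. exp (- lam * T)) \<longlongrightarrow> 0) at_top"
      by (intro filterlim_compose[OF exp_at_bot]) (simp add: filterlim_uminus_at_bot)
  qed
  then have "test_value \<epsilon> j0 x0 \<le> 0 * B + (cost l lam \<alpha> x i + \<kappa> / lam)"
    by (rule tendsto_lowerbound) (use bound in \<open>auto simp: eventually_at_top_linorder\<close>)
  then show ?thesis by (simp add: \<kappa>_def)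
qed

text \<open>
  Needed because the infimum of the empty set is unspecified. A constant control that moves away
  from the junction yields a trajectory staying in its branch, so that no switch occurs.
\<close>

lemma trajectory_exists:
  assumes j: "j \<in> {1, -1}" and x0: "0 < of_int j * x0" and \<epsilon>: "0 < \<epsilon>"
  shows "\<exists>\<alpha> x i. \<alpha> \<in> controls A \<and> trajectory f \<epsilon> x0 j \<alpha> x i"
proof -
  interpret half_line_subsolution A lam L M \<omega> "dyn j" "rate j" "profile j" by (rule half_line[OF j])
  have jj: "of_int j * (of_int j * z) = z" for z :: real using j by auto
  obtain a where a: "a \<in> A" "0 < dyn j 0 a" using outward by blast
  define G where "G y = dyn j (max y 0) a" for y
  have Lip: "\<bar>G y - G z\<bar> \<le> L * \<bar>y - z\<bar>" for y z
  proof -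
    have "\<bar>G y - G z\<bar> \<le> L * \<bar>max y 0 - max z 0\<bar>" unfolding G_def using a(1) by (intro g_Lipschitz) auto
    also have "\<dots> \<le> L * \<bar>y - z\<bar>" using L_nonneg by (intro mult_left_mono) auto
    finally show ?thesis .
  qed
  have bd: "\<bar>G y\<bar> \<le> M" for y unfolding G_def using a(1) by (intro g_bound) auto
  obtain Y :: "real \<Rightarrow> real" where Y: "continuous_on {0..} Y"
    "\<And>t. 0 \<le> t \<Longrightarrow> Y t = of_int j * x0 + integral {0..t} (\<lambda>s. G (Y s))"
    using scalar_ode_exists[OF L_nonneg Lip bd, of "of_int j * x0"] by blast
  have "continuous_on UNIV G"
    by (rule lipschitz_on_continuous_on[of L]) (auto simp: lipschitz_on_def dist_real_def Lip L_nonneg)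
  then have GYc: "continuous_on {0..t} (\<lambda>s. G (Y s))" for t
    by (rule continuous_on_compose2) (auto intro: continuous_on_subset[OF Y(1)])
  have Y0: "0 \<le> Y t" if t: "0 \<le> t" for t
  proof (rule ccontr)
    assume neg: "\<not> 0 \<le> Y t"
    \<comment> \<open>After its last nonnegative time, \<open>Y\<close> moves with the positive velocity \<open>dyn j 0 a\<close>.\<close>
    define S where "S = {s \<in> {0..t}. 0 \<le> Y s}"
    have "closed S"
    proof -
      have "S = {0..t} \<inter> Y -` {0..}" by (auto simp: S_def)
      moreover have "continuous_on {0..t} Y" by (rule continuous_on_subset[OF Y(1)]) auto
      ultimately show ?thesis by (auto intro: continuous_closed_preimage)
    qed
    moreover have "S \<noteq> {}" using Y(2)[of 0] x0 t by (force simp: S_def)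
    moreover have bdd: "bdd_above S" by (auto simp: S_def bdd_above_def)
    ultimately have "Sup S \<in> S" by (intro closed_contains_Sup)
    then obtain s where s: "s \<in> {0..t}" "0 \<le> Y s" "s = Sup S" by (auto simp: S_def)
    have "Y \<rho> \<le> 0" if "\<rho> \<in> {s<..t}" for \<rho>
    proof (rule ccontr)
      assume "\<not> Y \<rho> \<le> 0"
      then have "\<rho> \<in> S" using that s by (auto simp: S_def)
      then have "\<rho> \<le> s" unfolding s(3) by (rule cSup_upper[OF _ bdd])
      then show False using that by simp
    qed
    then have const: "G (Y \<rho>) = dyn j 0 a" if "\<rho> \<in> {s<..t}" for \<rho> using that by (auto simp: G_def max_def)
    have "integral {0..s} (\<lambda>s. G (Y s)) + integral {s..t} (\<lambda>s. G (Y s)) = integral {0..t} (\<lambda>s. G (Y s))"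
      using s by (intro Henstock_Kurzweil_Integration.integral_combine integrable_continuous_interval GYc) auto
    moreover have "0 \<le> integral {s..t} (\<lambda>s. G (Y s))"
    proof -
      have "integral {s..t} (\<lambda>s. G (Y s)) = integral {s..t} (\<lambda>_. dyn j 0 a)"
        by (rule integral_spike[of "{s}"]) (auto simp: const[symmetric])
      then show ?thesis using s a(2) by simp
    qed
    ultimately have "Y s \<le> Y t" using Y(2)[of s] Y(2)[of t] s t by auto
    then show False using s(2) neg by simp
  qed
  define x where "x t = of_int j * Y t" for t
  have "trajectory f \<epsilon> x0 j (\<lambda>_. a) x (\<lambda>_. j)"
    unfolding trajectory_def
  proof (intro conjI allI impI)
    fix t :: real assume t: "0 \<le> t"
    have eq: "extend_const f j (x s) a = of_int j * G (Y s)" for s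
      by (simp add: extend_dyn[OF j] x_def jj G_def)
    have int: "set_integrable lebesgue {0..t} (\<lambda>s. of_int j * G (Y s))"
      by (rule absolutely_integrable_continuous_real) (intro continuous_intros GYc)
    then show "set_integrable lebesgue {0..t} (\<lambda>s. extend_const f j (x s) a)" by (simp add: eq)
    have "(LINT s:{0..t}|lebesgue. extend_const f j (x s) a) = of_int j * integral {0..t} (\<lambda>s. G (Y s))"
      unfolding eq set_lebesgue_integral_eq_integral(2)[OF int] by simp
    then show "x t = x0 + (LINT s:{0..t}|lebesgue. extend_const f j (x s) a)"
      using Y(2)[OF t] by (simp add: x_def distrib_left jj)
  next
    have "continuous_on {0..} x" unfolding x_def by (intro continuous_intros Y(1))
    moreover have "0 \<le> of_int j * x t" if "0 \<le> t" for t using Y0[OF that] by (simp add: x_def jj)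
    ultimately show "thermostat \<epsilon> x j (\<lambda>_. j)"
      using j \<epsilon> unfolding thermostat_def by force
  qed
  moreover have "(\<lambda>_. a) \<in> controls A" using a(1) by (simp add: controls_def)
  ultimately show ?thesis by blast
qed

lemma test_value_le_value:
  assumes \<epsilon>: "0 < \<epsilon>" and x: "x \<noteq> 0"
  shows "test_value \<epsilon> (if x > 0 then 1 else -1) x - error \<epsilon> / lam \<le> glued_value A lam f l \<epsilon> x"
  unfolding glued_value_def value_fun_def
proof (rule cInf_greatest)
  define j :: int where "j = (if x > 0 then 1 else -1)"
  have "j \<in> {1, -1}" "0 < of_int j * x" using x by (auto simp: j_def)
  from trajectory_exists[OF this \<epsilon>]
  show "{cost l lam \<alpha> y i |\<alpha> y i. \<alpha> \<in> controls A \<and> trajectory f \<epsilon> x (if x > 0 then 1 else -1) \<alpha> y i} \<noteq> {}"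
    unfolding j_def by blast
qed (use test_value_le_cost[OF \<epsilon>] in force)

lemma error_tendsto: "(error \<longlongrightarrow> 0) (at_right 0)"
proof -
  have "((\<lambda>\<epsilon>. half_line_subsolution.defect lam L \<omega> (profile j) (slope j) \<epsilon>) \<longlongrightarrow> 0) (at_right 0)"
    if j: "j \<in> {1, -1}" for j
  proof -
    interpret half_line_subsolution A lam L M \<omega> "dyn j" "rate j" "profile j" by (rule half_line[OF j])
    have u: "(profile j \<longlongrightarrow> profile j 0) (at_right 0)"
      using u_cont by (auto simp: continuous_on_def intro: tendsto_within_subset)
    have "((\<lambda>\<epsilon>. defect (slope j) \<epsilon>) \<longlongrightarrow> lam * \<bar>profile j 0 + slope j * 0 - profile j 0\<bar>
        + (2 * lam + L) * \<bar>slope j\<bar> * 0 + 0) (at_right 0)"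
      unfolding defect_def by (intro tendsto_intros u \<omega>_tendsto)
    then show ?thesis by simp
  qed
  then have "(error \<longlongrightarrow> (\<Sum>j\<in>{1, -1 :: int}. 0)) (at_right 0)"
    unfolding error_def[abs_def] by (intro tendsto_sum)
  then show ?thesis by simp
qed

lemma test_value_tendsto:
  assumes "x \<noteq> 0"
  shows "((\<lambda>\<epsilon>. test_value \<epsilon> (if x > 0 then 1 else -1) x) \<longlongrightarrow> u x) (at_right 0)"
proof -
  define j :: int where "j = (if x > 0 then 1 else -1)"
  have j: "j \<in> {1, -1}" and jx: "of_int j * x = \<bar>x\<bar>" and jj: "of_int j * \<bar>x\<bar> = x"
    by (auto simp: j_def)
  interpret half_line_subsolution A lam L M \<omega> "dyn j" "rate j" "profile j" by (rule half_line[OF j])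
  have u: "(profile j \<longlongrightarrow> profile j 0) (at_right 0)"
    using u_cont by (auto simp: continuous_on_def intro: tendsto_within_subset)
  have "((\<lambda>\<epsilon>. u x + (profile j 0 + slope j * \<epsilon> - profile j \<epsilon>)) \<longlongrightarrow>
      u x + (profile j 0 + slope j * 0 - profile j 0)) (at_right 0)"
    by (intro tendsto_intros u)
  moreover have "\<forall>\<^sub>F \<epsilon> in at_right 0. \<epsilon> < \<bar>x\<bar>"
    using assms by (intro eventually_at_right_less[THEN eventually_mono] order_tendstoD(2)[OF tendsto_ident_at]) auto
  then have "\<forall>\<^sub>F \<epsilon> in at_right 0. test_value \<epsilon> j x = u x + (profile j 0 + slope j * \<epsilon> - profile j \<epsilon>)"
    by eventually_elim (simp add: test_value_def jx glued_def profile_def[of j "\<bar>x\<bar>"] jj)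
  ultimately show ?thesis
    unfolding j_def[symmetric] by (simp add: tendsto_cong)
qed

lemma le_limit_value:
  assumes lim: "\<And>x. x \<noteq> 0 \<Longrightarrow> ((\<lambda>\<epsilon>. glued_value A lam f l \<epsilon> x) \<longlongrightarrow> V x) (at_right 0)"
    and V: "continuous_on UNIV V"
  shows "u x \<le> V x"
proof -
  have off: "u x \<le> V x" if x: "x \<noteq> 0" for x
  proof (rule tendsto_le[OF trivial_limit_at_right_real lim[OF x]])
    show "((\<lambda>\<epsilon>. test_value \<epsilon> (if x > 0 then 1 else -1) x - error \<epsilon> / lam) \<longlongrightarrow> u x) (at_right 0)"
      using tendsto_diff[OF test_value_tendsto[OF x] tendsto_divide[OF error_tendsto tendsto_const, of lam]] lam_pos
      by simp
    show "\<forall>\<^sub>F \<epsilon> in at_right 0. test_value \<epsilon> (if x > 0 then 1 else -1) x - error \<epsilon> / lam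
        \<le> glued_value A lam f l \<epsilon> x"
      using eventually_at_right_less[of "0::real"] by eventually_elim (rule test_value_le_value[OF _ x])
  qed
  have "u 0 \<le> V 0"
  proof (rule tendsto_le)
    show "(V \<longlongrightarrow> V 0) (at 0)" using V by (auto simp: continuous_on_def)
    show "(u \<longlongrightarrow> u 0) (at 0)"
      using junction_sub by (auto simp: junction_subsolution_def continuous_on_def)
    show "\<forall>\<^sub>F x in at 0. u x \<le> V x" using off by (auto simp: eventually_at_filter)
  qed simp
  with off show ?thesis by (cases "x = 0") auto
qed

end

theorem theorem3p5:
  fixes A :: "'a::topological_space set"
    and lam :: real
    and f l :: "int \<Rightarrow> real \<Rightarrow> 'a \<Rightarrow> real"
    and Vt u :: "real \<Rightarrow> real"
  assumes "junction_control A lam f l"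
    and "uniform_limit (- {0}) (\<lambda>\<epsilon>. glued_value A lam f l \<epsilon>) Vt (at_right 0)"
    and "continuous_on UNIV Vt"
    and "bounded (range u)"
    and "junction_subsolution A lam f l u"
  shows "\<forall>x. u x \<le> Vt x"
proof -
  interpret junction_control A lam f l by fact
  obtain L where L: "0 < L" "\<forall>i\<in>{1, -1}. \<forall>x\<in>branch i. \<forall>y\<in>branch i. \<forall>a\<in>A.
      \<bar>f i x a - f i y a\<bar> \<le> L * \<bar>x - y\<bar>"
    using f_Lipschitz by blast
  obtain \<omega> :: "real \<Rightarrow> real" where \<omega>: "continuous_on {0..} \<omega>" "mono_on {0..} \<omega>" "\<omega> 0 = 0"
    "\<forall>i\<in>{1, -1}. \<forall>x\<in>branch i. \<forall>y\<in>branch i. \<forall>a\<in>A. \<bar>l i x a - l i y a\<bar> \<le> \<omega> \<bar>x - y\<bar>"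
    using l_modulus by blast
  define S where "S = (\<Union>i\<in>{1, -1}. (\<lambda>(x, a). f i x a) ` (branch i \<times> A) \<union> (\<lambda>(x, a). l i x a) ` (branch i \<times> A))"
  have "bounded S"
    unfolding S_def using f_bounded l_bounded by (intro bounded_UN) auto
  then obtain M where M: "\<forall>y\<in>S. \<bar>y\<bar> \<le> M" by (auto simp: bounded_iff)
  interpret junction_subsolution_problem A lam f l u L M \<omega>
  proof
    show "\<bar>f j x a\<bar> \<le> M" if "j \<in> {1, -1}" "x \<in> branch j" "a \<in> A" for j x a
      using that by (intro bspec[OF M]) (force simp: S_def)
    show "l j x a \<le> M" if "j \<in> {1, -1}" "x \<in> branch j" "a \<in> A" for j x a
    proof -
      have "\<bar>l j x a\<bar> \<le> M"
        using that by (intro bspec[OF M]) (force simp: S_def)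
      then show ?thesis by simp
    qed
    show "\<bar>f j x a - f j y a\<bar> \<le> L * \<bar>x - y\<bar>" if "j \<in> {1, -1}" "x \<in> branch j" "y \<in> branch j" "a \<in> A" for j x y a
      using L(2) that by blast
    show "\<bar>l j x a - l j y a\<bar> \<le> \<omega> \<bar>x - y\<bar>" if "j \<in> {1, -1}" "x \<in> branch j" "y \<in> branch j" "a \<in> A" for j x y a
      using \<omega>(4) that by blast
  qed (use assms L(1) \<omega>(1-3) in auto)
  have "((\<lambda>\<epsilon>. glued_value A lam f l \<epsilon> x) \<longlongrightarrow> Vt x) (at_right 0)" if "x \<noteq> 0" for x
    using tendsto_uniform_limitI[OF assms(2)] that by simp
  then show ?thesis using le_limit_value[OF _ assms(3)] by blast
qed

end
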